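(* Let $f:\mathbb{D}\to\widehat{\mathbb{C}}$ be a spherically convex function. Then $$A_s f(r\mathbb{D})\ge A_s(r\mathbb{D})\,f^{\sharp}(0)^2\quad\text{for every } 0<r<1.$$ Moreover, equality holds for some $0<r<1$ if and only if $f$ is a spherical isometry.
   Context: $\mathbb{D}=\{z\in\mathbb{C}:|z|<1\}$, $\widehat{\mathbb{C}}=\mathbb{C}\cup\{\infty\}$ is the Riemann sphere with the spherical metric $\frac{|dz|}{1+|z|^2}$ (Gaussian curvature $+4$). For two non-antipodal points $a,b\in\widehat{\mathbb{C}}$, the spherical geodesic joining them is the smaller arc of the great circle through $a$ and $b$. A domain $\Omega\subset\widehat{\mathbb{C}}$ is spherically convex if for any two points $a,b\in\Omega$ that are not antipodal the spherical geodesic joining $a$ and $b$ lies in $\Omega$. A meromorphic univalent (injective) map $f:\mathbb{D}\to\widehat{\mathbb{C}}$ is called spherically convex if $f(\mathbb{D})$ is a spherically convex domain. The group of (meromorphic) spherical isometries is $$\mathrm{Rot}(\widehat{\mathbb{C}})=\left\{e^{i\theta}\frac{z-a}{1+z\overline{a}}: a\in\mathbb{C},\theta\in\mathbb{R}\right\}\cup\left\{\frac{e^{i\theta}}{z}:\theta\in\mathbb{R}\right\};$$ "$f$ is a spherical isometry" means that $f$ is the restriction to $\mathbb{D}$ of an element of $\mathrm{Rot}(\widehat{\mathbb{C}})$. The spherical derivative is $f^{\sharp}(z)=\frac{|f'(z)|}{1+|f(z)|^2}$ (at a pole of $f$ defined by continuous extension). With $dA$ Lebesgue area measure and $r\mathbb{D}=\{|z|<r\}$,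 $$A_s f(r\mathbb{D})=\iint_{r\mathbb{D}}f^{\sharp}(z)^2\,dA(z),\qquad A_s(r\mathbb{D})=\iint_{r\mathbb{D}}\frac{dA(z)}{(1+|z|^2)^2}=\frac{\pi r^2}{1+r^2}.$$ *)

theory Defs
  imports "HOL-Complex_Analysis.Complex_Analysis"
begin

text \<open>The Riemann sphere is the one-point compactification of the complex plane, carried by the
  type \<^typ>\<open>complex option\<close> with \<^term>\<open>None\<close> as the point at infinity.\<close>

type_synonym rsphere = "complex option"

definition rsphere_topology :: "rsphere topology" where
  "rsphere_topology = Alexandroff_compactification euclidean"

definition fin_val :: "rsphere \<Rightarrow> complex" where
  "fin_val p = (case p of None \<Rightarrow> 0 | Some w \<Rightarrow> w)"

text \<open>A nicely meromorphic function has the value 0 at its poles, whence the default value in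
  \<^const>\<open>fin_val\<close>. The second conjunct makes infinity the value exactly at the poles; it
  excludes in particular the constant infinity.\<close>

definition meromorphic_map_on :: "(complex \<Rightarrow> rsphere) \<Rightarrow> complex set \<Rightarrow> bool" where
  "meromorphic_map_on f S \<longleftrightarrow>
     (\<lambda>z. fin_val (f z)) nicely_meromorphic_on S \<and>
     (\<forall>z\<in>S. f z = None \<longleftrightarrow> is_pole (\<lambda>w. fin_val (f w)) z)"

text \<open>Stereographic projection onto the unit sphere of \<open>\<complex> \<times> \<real>\<close>. It carries the metric
  \<open>|dz| / (1 + |z|^2)\<close> to half of the Euclidean arc length of the unit sphere, so that the spherical
  geodesics and great circles are those of the unit sphere.\<close>

definition stereo :: "rsphere \<Rightarrow> complex \<times> real" where
  "stereo p = (case p of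
      None \<Rightarrow> (0, 1)
    | Some z \<Rightarrow> ((2 / (1 + (cmod z)\<^sup>2)) *\<^sub>R z, ((cmod z)\<^sup>2 - 1) / ((cmod z)\<^sup>2 + 1)))"

definition antipodal :: "rsphere \<Rightarrow> rsphere \<Rightarrow> bool" where
  "antipodal a b \<longleftrightarrow> stereo b = - stereo a"

text \<open>The great-circle arc of angular length \<open>L\<close> that starts at the unit vector \<open>u\<close> in the direction
  of the unit tangent vector \<open>v\<close>.\<close>

definition great_circle_arc ::
  "complex \<times> real \<Rightarrow> complex \<times> real \<Rightarrow> real \<Rightarrow> (complex \<times> real) set" where
  "great_circle_arc u v L = (\<lambda>t. cos t *\<^sub>R u + sin t *\<^sub>R v) ` {0..L}"

text \<open>The bound \<open>L < \<pi>\<close> selects the smaller of the two arcs joining non-antipodal points. The arc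
  from \<open>a\<close> to itself has \<open>L = 0\<close> and is a point.\<close>

definition spherical_geodesic :: "rsphere \<Rightarrow> rsphere \<Rightarrow> rsphere set" where
  "spherical_geodesic a b =
     {p. \<exists>u v L. norm u = 1 \<and> norm v = 1 \<and> u \<bullet> v = 0 \<and> 0 \<le> L \<and> L < pi \<and>
           stereo a = u \<and> stereo b = cos L *\<^sub>R u + sin L *\<^sub>R v \<and>
           stereo p \<in> great_circle_arc u v L}"

definition rsphere_domain :: "rsphere set \<Rightarrow> bool" where
  "rsphere_domain \<Omega> \<longleftrightarrow>
     \<Omega> \<noteq> {} \<and> openin rsphere_topology \<Omega> \<and> connectedin rsphere_topology \<Omega>"

definition spherically_convex_domain :: "rsphere set \<Rightarrow> bool" where
  "spherically_convex_domain \<Omega> \<longleftrightarrow>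
     rsphere_domain \<Omega> \<and>
     (\<forall>a\<in>\<Omega>. \<forall>b\<in>\<Omega>. \<not> antipodal a b \<longrightarrow> spherical_geodesic a b \<subseteq> \<Omega>)"

definition spherically_convex_map :: "(complex \<Rightarrow> rsphere) \<Rightarrow> bool" where
  "spherically_convex_map f \<longleftrightarrow>
     meromorphic_map_on f (ball 0 1) \<and> inj_on f (ball 0 1) \<and>
     spherically_convex_domain (f ` ball 0 1)"

definition moebius ::
  "complex \<Rightarrow> complex \<Rightarrow> complex \<Rightarrow> complex \<Rightarrow> rsphere \<Rightarrow> rsphere" where
  "moebius a b c d p = (case p of
      None \<Rightarrow> if c = 0 then None else Some (a / c)
    | Some z \<Rightarrow> if c * z + d = 0 then None else Some ((a * z + b) / (c * z + d)))"

definition Rot :: "(rsphere \<Rightarrow> rsphere) set" where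
  "Rot = {moebius (cis \<theta>) (- cis \<theta> * a) (cnj a) 1 | a \<theta>. True} \<union>
         {moebius 0 (cis \<theta>) 1 0 | \<theta>. True}"

definition spherical_isometry_on_disc :: "(complex \<Rightarrow> rsphere) \<Rightarrow> bool" where
  "spherical_isometry_on_disc f \<longleftrightarrow> (\<exists>T\<in>Rot. \<forall>z\<in>ball 0 1. f z = T (Some z))"

definition finite_sph_deriv :: "(complex \<Rightarrow> complex) \<Rightarrow> complex \<Rightarrow> real" where
  "finite_sph_deriv g z = cmod (deriv g z) / (1 + (cmod (g z))\<^sup>2)"

definition sph_deriv :: "(complex \<Rightarrow> rsphere) \<Rightarrow> complex \<Rightarrow> real" where
  "sph_deriv f z =
     (let g = (\<lambda>w. fin_val (f w))
      in if f z = None then Lim (at z) (finite_sph_deriv g) else finite_sph_deriv g z)"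

definition sph_area_image :: "(complex \<Rightarrow> rsphere) \<Rightarrow> real \<Rightarrow> real" where
  "sph_area_image f r = (LINT z:ball 0 r|lborel. (sph_deriv f z)\<^sup>2)"

definition sph_area_disc :: "real \<Rightarrow> real" where
  "sph_area_disc r = (LINT z:ball (0::complex) r|lborel. 1 / (1 + (cmod z)\<^sup>2)\<^sup>2)"

end

theory Submission
  imports Defs
begin

text \<open>
  The spherical area and the spherical derivative do not change under rotations of the sphere, so the
  point \<open>f 0\<close> may be moved to \<open>0\<close>. The rotated map \<open>F\<close> turns out to be holomorphic and
  univalent, and \<open>F z = z * G z\<close> with \<open>G\<close> free of zeros. Put \<open>a = |F'(0)|\<^sup>2\<close>,
  which is the square of the spherical derivative of \<open>f\<close> at \<open>0\<close>, and let \<open>A(r)\<close> be the spherical area of the image of the disc of radius \<open>r\<close>. The proof combines two bounds, \<open>a \<le> 1\<close> and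
  \<open>A(r) \<ge> \<pi> r\<^sup>2 a / (1 + r\<^sup>2 a)\<close>; the right side is at least \<open>a \<pi> r\<^sup>2 / (1 + r\<^sup>2)\<close>.

  Convexity enters only through a supporting hemisphere. A spherically convex image has no antipodal
  pairs, since otherwise it would be the whole sphere, which is not the image of a disc under an injective map. The
  cone over the image in space is then convex without the origin, and a separating plane gives a
  closed hemisphere that contains the image (\<open>spherically_convex_map_in_hemisphere\<close>). The Schwarz lemma in this
  hemisphere yields \<open>|F z|\<^sup>2 (1 - |z|\<^sup>2) \<le> |z|\<^sup>2\<close>, in particular \<open>a \<le> 1\<close>, with \<open>a = 1\<close> only for
  \<open>F z = \<eta> z\<close> (\<open>growth_in_hemisphere\<close>).

  The area bound (\<open>spherical_area_lower_bound\<close>) says that a round disc about \<open>0\<close> has the smallest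
  area for given \<open>|F'(0)|\<close>. By Stokes the area is the circle integral
  of \<open>\<Phi>(log |F|) Re (z F' / F) / 2\<close>, where \<open>\<Phi>(s) = e\<^bsup>2s\<^esup> / (1 + e\<^bsup>2s\<^esup>)\<close>. Since \<open>log |G|\<close> is harmonic, Green's formula
  expresses the excess of the area over the bound as an integral of \<open>|\<nabla> log |G||\<^sup>2\<close> against an explicit
  weight, a combination of \<open>\<Phi>'\<close> and \<open>\<Phi>''\<close>. As \<open>\<Phi>\<close> is not convex, the weight could be negative where \<open>|F|\<close> is
  large, but the growth bound prevents this.

  Equality in the theorem forces \<open>a = 1\<close>, because \<open>a > 0\<close>. Then \<open>F\<close> is a rotation about the origin and \<open>f\<close> an isometry.
\<close>

section \<open>Polar coordinates in the complex plane\<close>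

text \<open>This identification gives access to Fubini and to one-dimensional translation invariance.\<close>

lemma lborel_complex_eq_distr_prod:
  "(lborel :: complex measure) = distr (lborel \<Otimes>\<^sub>M lborel) borel (\<lambda>p. Complex (fst p) (snd p))"
proof (rule lborel_eqI)
  have meas: "(\<lambda>p. Complex (fst p) (snd p)) \<in> borel_measurable (lborel \<Otimes>\<^sub>M lborel)"
    unfolding lborel_prod
    by (auto intro!: borel_measurable_continuous_onI continuous_intros simp: Complex_eq)
  fix l u :: complex
  assume le: "\<And>b. b \<in> Basis \<Longrightarrow> l \<bullet> b \<le> u \<bullet> b"
  have le': "Re l \<le> Re u" "Im l \<le> Im u"
    using le[of 1] le[of \<i>] by (auto simp: Basis_complex_def inner_complex_def)
  have "(\<lambda>p. Complex (fst p) (snd p)) -` box l u \<inter> space (lborel \<Otimes>\<^sub>M lborel)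
          = {Re l<..<Re u} \<times> {Im l<..<Im u}"
    by (auto simp: box_def Basis_complex_def inner_complex_def space_pair_measure)
  then show "emeasure (distr (lborel \<Otimes>\<^sub>M lborel) borel (\<lambda>p. Complex (fst p) (snd p))) (box l u)
          = ennreal (\<Prod>b\<in>Basis. (u - l) \<bullet> b)"
    using meas le'
    by (subst emeasure_distr)
       (auto simp: lborel.emeasure_pair_measure_Times Basis_complex_def inner_complex_def
          complex_i_not_one ennreal_mult'[symmetric] diff_ge_0_iff_ge)
qed simp

lemma nn_integral_complex_iterated:
  assumes [measurable]: "g \<in> borel_measurable (borel :: complex measure)"
  shows "(\<integral>\<^sup>+z. g z \<partial>lborel) = (\<integral>\<^sup>+x. \<integral>\<^sup>+y. g (Complex x y) \<partial>lborel \<partial>lborel)" (is ?A)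
    and "(\<integral>\<^sup>+z. g z \<partial>lborel) = (\<integral>\<^sup>+y. \<integral>\<^sup>+x. g (Complex x y) \<partial>lborel \<partial>lborel)" (is ?B)
proof -
  have meas[measurable]: "(\<lambda>p. Complex (fst p) (snd p)) \<in> borel_measurable (lborel \<Otimes>\<^sub>M lborel)"
    unfolding lborel_prod
    by (auto intro!: borel_measurable_continuous_onI continuous_intros simp: Complex_eq)
  have meas'[measurable]: "(\<lambda>p. g (Complex (fst p) (snd p))) \<in> borel_measurable (lborel \<Otimes>\<^sub>M lborel)"
    using measurable_compose[OF meas assms] .
  have *: "(\<integral>\<^sup>+z. g z \<partial>lborel) = (\<integral>\<^sup>+p. g (Complex (fst p) (snd p)) \<partial>(lborel \<Otimes>\<^sub>M lborel))"
    by (subst lborel_complex_eq_distr_prod, subst nn_integral_distr) auto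
  show ?A
    unfolding * by (subst lborel.nn_integral_fst[symmetric]) auto
  show ?B
    unfolding * using lborel_pair.nn_integral_snd[OF meas'] by (simp add: split_def)
qed

lemma nn_integral_complex_horizontal_shear:
  assumes [measurable]: "g \<in> borel_measurable (borel :: complex measure)"
  shows "(\<integral>\<^sup>+z. g (z + of_real (k * Im z)) \<partial>lborel) = (\<integral>\<^sup>+z. g z \<partial>lborel)"
proof -
  have [measurable]: "(\<lambda>x. Complex x y) \<in> borel_measurable borel" for y
    unfolding Complex_eq by measurable
  have "(\<integral>\<^sup>+x. g (Complex x y) \<partial>lborel) = (\<integral>\<^sup>+x. g (Complex (k * y + 1 * x) y) \<partial>lborel)" for y
    by (subst nn_integral_real_affine[where c = 1 and t = "k * y"]) auto
  moreover have "Complex x y + of_real (k * y) = Complex (k * y + 1 * x) y" for x y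
    by (simp add: complex_eq_iff)
  ultimately show ?thesis
    by (subst (1 2) nn_integral_complex_iterated(2)) auto
qed

lemma nn_integral_complex_vertical_shear:
  assumes [measurable]: "g \<in> borel_measurable (borel :: complex measure)"
  shows "(\<integral>\<^sup>+z. g (z + \<i> * of_real (k * Re z)) \<partial>lborel) = (\<integral>\<^sup>+z. g z \<partial>lborel)"
proof -
  have [measurable]: "(\<lambda>y. Complex x y) \<in> borel_measurable borel" for x
    unfolding Complex_eq by measurable
  have "(\<integral>\<^sup>+y. g (Complex x y) \<partial>lborel) = (\<integral>\<^sup>+y. g (Complex x (k * x + 1 * y)) \<partial>lborel)" for x
    by (subst nn_integral_real_affine[where c = 1 and t = "k * x"]) auto
  moreover have "Complex x y + \<i> * of_real (k * x) = Complex x (k * x + 1 * y)" for x y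
    by (simp add: complex_eq_iff)
  ultimately show ?thesis
    by (subst (1 2) nn_integral_complex_iterated(1)) auto
qed

text \<open>A rotation that is not real is the product of three shears, horizontal, vertical, horizontal, and a
  shear only translates along lines. A real unit is the product of two non-real ones.\<close>

lemma nn_integral_complex_rotation:
  assumes [measurable]: "g \<in> borel_measurable (borel :: complex measure)" and "cmod u = 1"
  shows "(\<integral>\<^sup>+z. g (u * z) \<partial>lborel) = (\<integral>\<^sup>+z. g z \<partial>lborel)"
proof -
  have *: "(\<integral>\<^sup>+z. h (v * z) \<partial>lborel) = (\<integral>\<^sup>+z. h z \<partial>lborel)"
    if [measurable]: "h \<in> borel_measurable borel" and v: "cmod v = 1" "Im v \<noteq> 0"
    for h :: "complex \<Rightarrow> ennreal" and v
  proof -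
    \<comment> \<open>With \<open>v = cos \<tau> + \<i> sin \<tau>\<close>, this is \<open>- tan (\<tau> / 2)\<close>, the slope of the two horizontal shears.\<close>
    define k where "k = (Re v - 1) / Im v"
    define A B where "A = (\<lambda>z. z + of_real (k * Im z))" and "B = (\<lambda>z. z + \<i> * of_real (Im v * Re z))"
    have [measurable]: "A \<in> borel_measurable borel" "B \<in> borel_measurable borel"
      unfolding A_def B_def by measurable
    have sq: "(Re v)\<^sup>2 + (Im v)\<^sup>2 = 1"
      using v(1) by (metis cmod_power2 one_power2)
    have c1: "1 + k * Im v = Re v"
      using v by (simp add: k_def)
    have "k * (1 + Re v) = - Im v"
      using v(2) sq by (simp add: k_def field_simps power2_eq_square)
    then have c2: "2 * k + k * k * Im v = - Im v"
      using c1 by algebra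
    have "v * z = A (B (A z))" for z
    proof (rule complex_eqI)
      show "Im (v * z) = Im (A (B (A z)))"
        using arg_cong[OF c1, of "\<lambda>x. x * Im z"] by (simp add: A_def B_def algebra_simps)
      show "Re (v * z) = Re (A (B (A z)))"
        using arg_cong[OF c1, of "\<lambda>x. x * Re z"] arg_cong[OF c2, of "\<lambda>x. x * Im z"]
        by (simp add: A_def B_def algebra_simps)
    qed
    then have "(\<integral>\<^sup>+z. h (v * z) \<partial>lborel) = (\<integral>\<^sup>+z. h (A (B (A z))) \<partial>lborel)"
      by simp
    also have "\<dots> = (\<integral>\<^sup>+z. h z \<partial>lborel)"
      using nn_integral_complex_horizontal_shear[of "\<lambda>z. h (A (B z))" k]
        nn_integral_complex_vertical_shear[of "\<lambda>z. h (A z)" "Im v"]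
        nn_integral_complex_horizontal_shear[of h k]
      by (simp add: A_def[symmetric] B_def[symmetric])
         (simp add: A_def B_def)
    finally show ?thesis .
  qed
  show ?thesis
  proof (cases "Im u = 0")
    case False
    then show ?thesis
      using * assms by blast
  next
    case True
    then have "Im (- \<i> * u) \<noteq> 0"
      using assms(2) by (auto simp: cmod_def)
    then have "(\<integral>\<^sup>+z. g (\<i> * (- \<i> * u * z)) \<partial>lborel) = (\<integral>\<^sup>+z. g (\<i> * z) \<partial>lborel)"
      using *[of "\<lambda>z. g (\<i> * z)" "- \<i> * u"] assms(2) by (simp add: norm_mult)
    also have "\<dots> = (\<integral>\<^sup>+z. g z \<partial>lborel)"
      by (rule *) auto
    finally show ?thesis
      by (simp add: mult.assoc[symmetric])
  qed
qed

lemma integral_periodic_shift: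
  fixes q :: "real \<Rightarrow> real"
  assumes cont: "continuous_on UNIV q" and per: "\<And>x. q (x + p) = q x" and \<alpha>: "0 \<le> \<alpha>" "\<alpha> \<le> p"
  shows "integral {0..p} (\<lambda>x. q (x + \<alpha>)) = integral {0..p} q"
proof -
  have int: "q integrable_on {a..b}" for a b
    by (rule integrable_continuous_interval) (rule continuous_on_subset[OF cont], simp)
  have shift: "integral {a..b} (\<lambda>x. q (x + c)) = integral {a + c..b + c} q" for a b c
    using integral_shift[of a c b q] continuous_on_subset[OF cont] by (simp add: o_def)
  have "integral {0..p} (\<lambda>x. q (x + \<alpha>)) = integral {\<alpha>..p + \<alpha>} q"
    by (simp add: shift)
  also have "\<dots> = integral {\<alpha>..p} q + integral {p..p + \<alpha>} q"
    using \<alpha> int by (intro Henstock_Kurzweil_Integration.integral_combine[symmetric]) auto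
  also have "integral {p..p + \<alpha>} q = integral {0..\<alpha>} q"
    using shift[of 0 \<alpha> p] per by (simp add: add.commute)
  also have "integral {\<alpha>..p} q + integral {0..\<alpha>} q = integral {0..p} q"
    using \<alpha> int Henstock_Kurzweil_Integration.integral_combine[of 0 \<alpha> p q] by simp
  finally show ?thesis .
qed

text \<open>Averaging over all rotations leaves only the dependence on the modulus.\<close>

lemma circle_integral_radial:
  fixes k :: "complex \<Rightarrow> real"
  assumes cont: "continuous_on (cball 0 r) k" and z: "cmod z \<le> r"
  shows "integral {0..2*pi} (\<lambda>\<theta>. k (cis \<theta> * z)) = integral {0..2*pi} (\<lambda>\<theta>. k (of_real (cmod z) * cis \<theta>))"
proof -
  define q where "q = (\<lambda>\<theta>. k (of_real (cmod z) * cis \<theta>))"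
  have "z = of_real (cmod z) * cis (Arg2pi z)"
    by (metis Arg2pi_eq cis_conv_exp)
  then have "cis \<theta> * z = of_real (cmod z) * cis (\<theta> + Arg2pi z)" for \<theta>
    by (metis cis_mult mult.commute mult.left_commute)
  then have "integral {0..2*pi} (\<lambda>\<theta>. k (cis \<theta> * z)) = integral {0..2*pi} (\<lambda>\<theta>. q (\<theta> + Arg2pi z))"
    by (simp add: q_def)
  also have "\<dots> = integral {0..2*pi} q"
  proof (rule integral_periodic_shift)
    show "continuous_on UNIV q"
      unfolding q_def
      by (rule continuous_on_compose2[OF cont]) (use z in \<open>auto intro!: continuous_intros simp: norm_mult\<close>)
    show "q (x + 2 * pi) = q x" for x
      by (simp add: q_def cis_mult[symmetric])
  qed (use Arg2pi_ge_0[of z] Arg2pi_lt_2pi[of z] in auto)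
  finally show ?thesis
    by (simp add: q_def)
qed

text \<open>Half-lines determine a finite measure on the line, so the area of an annulus is all that is needed.\<close>

lemma distr_norm_lborel_disc:
  assumes "0 < r"
  shows "distr (restrict_space lborel (ball (0::complex) r)) borel norm
       = density lborel (\<lambda>t. ennreal (2 * pi * t) * indicator {0..r} t)" (is "?M = ?N")
proof (rule measure_eqI_lessThan)
  have meas: "norm \<in> borel_measurable (restrict_space lborel (ball (0::complex) r))"
    by (rule measurable_restrict_space1) simp
  have ball: "emeasure lborel (ball (0::complex) s) = ennreal (pi * s\<^sup>2)" if "0 \<le> s" for s
    using emeasure_ball[of s "0::complex"] that by (simp add: unit_ball_vol_2)
  have cball: "emeasure lborel (cball (0::complex) s) = ennreal (pi * s\<^sup>2)" if "0 \<le> s" for s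
    using emeasure_cball[of s "0::complex"] that by (simp add: unit_ball_vol_2)
  have eq: "emeasure ?M {x<..} = ennreal (pi * r\<^sup>2 - pi * (max 0 x)\<^sup>2) \<and> emeasure ?N {x<..} = ennreal (pi * r\<^sup>2 - pi * (max 0 x)\<^sup>2)"
    if "x \<le> r" for x
  proof
    have "emeasure ?M {x<..} = emeasure lborel ({z. x < cmod z} \<inter> ball 0 r)"
    proof (subst emeasure_distr[OF meas])
      have "cmod -` {x<..} \<inter> space (restrict_space lborel (ball 0 r)) = {z. x < cmod z} \<inter> ball 0 r"
        by (auto simp: space_restrict_space)
      then show "emeasure (restrict_space lborel (ball 0 r)) (cmod -` {x<..} \<inter> space (restrict_space lborel (ball 0 r)))
          = emeasure lborel ({z. x < cmod z} \<inter> ball 0 r)"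
        by (simp add: emeasure_restrict_space)
    qed simp
    also have "\<dots> = ennreal (pi * r\<^sup>2 - pi * (max 0 x)\<^sup>2)"
    proof (cases "x < 0")
      case True
      then have "{z. x < cmod z} \<inter> ball 0 r = ball 0 r"
        by (auto intro: less_le_trans)
      then show ?thesis
        using True assms by (simp add: ball)
    next
      case False
      show ?thesis
      proof (cases "x = r")
        case True
        then have "{z. x < cmod z} \<inter> ball 0 r = {}" by auto
        then show ?thesis using True assms by simp
      next
        case ne: False
        have "{z. x < cmod z} \<inter> ball 0 r = ball 0 r - cball 0 x"
          by auto
        moreover have "cball (0::complex) x \<subseteq> ball 0 r"
          using ne that by auto
        ultimately show ?thesis
          using False assms by (simp add: emeasure_Diff ball cball ennreal_minus)
      qed
    qed
    finally show "emeasure ?M {x<..} = \<dots>" .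
    have "emeasure ?N {x<..} = (\<integral>\<^sup>+t. ennreal (2 * pi * t) * indicator {0..r} t * indicator {x<..} t \<partial>lborel)"
      by (simp add: emeasure_density)
    also have "\<dots> = (\<integral>\<^sup>+t. ennreal (2 * pi * t) * indicator {max 0 x..r} t \<partial>lborel)"
    proof (rule nn_integral_cong_AE)
      have "AE t in lborel. t \<noteq> x"
        by (rule AE_lborel_singleton)
      then show "AE t in lborel. ennreal (2 * pi * t) * indicator {0..r} t * indicator {x<..} t
          = ennreal (2 * pi * t) * indicator {max 0 x..r} t"
        by eventually_elim (auto simp: indicator_def)
    qed
    also have "\<dots> = ennreal (pi * r\<^sup>2 - pi * (max 0 x)\<^sup>2)"
      using that assms
      by (intro nn_integral_FTC_Icc) (auto intro!: derivative_eq_intros simp: power2_eq_square)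
    finally show "emeasure ?N {x<..} = \<dots>" .
  qed
  have gt: "emeasure ?M {x<..} = 0 \<and> emeasure ?N {x<..} = 0" if "r < x" for x
  proof
    have "emeasure ?M {x<..} \<le> emeasure ?M {r<..}"
      using that by (intro emeasure_mono) auto
    then show "emeasure ?M {x<..} = 0"
      using eq[of r] assms by simp
    have "emeasure ?N {x<..} \<le> emeasure ?N {r<..}"
      using that by (intro emeasure_mono) auto
    then show "emeasure ?N {x<..} = 0"
      using eq[of r] assms by simp
  qed
  show "emeasure ?M {x<..} < \<infinity>" "emeasure ?M {x<..} = emeasure ?N {x<..}" for x
    using eq[of x] gt[of x] by (cases "x \<le> r"; force)+
qed auto

text \<open>By rotation invariance the integrand may be replaced by its mean over rotations, which is radial, and
  the modulus has the density \<open>2 \<pi> t\<close>. Working with nonnegative functions makes the interchange of the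
  two integrations unconditional.\<close>

lemma integral_disc_polar:
  fixes k :: "complex \<Rightarrow> real"
  assumes r: "0 < r" and cont: "continuous_on (cball 0 r) k"
    and nonneg: "\<And>z. z \<in> cball 0 r \<Longrightarrow> 0 \<le> k z"
  shows "(LINT z:ball 0 r|lborel. k z)
       = integral {0..r} (\<lambda>t. t * integral {0..2*pi} (\<lambda>\<theta>. k (of_real t * cis \<theta>)))"
proof -
  define h where "h t = integral {0..2*pi} (\<lambda>\<theta>. k (of_real t * cis \<theta>))" for t
  define K where "K z = indicator (ball 0 r) z *\<^sub>R k z" for z
  have K_meas[measurable]: "K \<in> borel_measurable borel"
    unfolding K_def
    by (rule borel_measurable_continuous_on_indicator) (auto intro: continuous_on_subset[OF cont])
  have K_nonneg: "0 \<le> K z" for z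
    using nonneg[of z] by (auto simp: K_def indicator_def)
  have h_cont: "continuous_on {0..r} h"
    unfolding h_def cbox_interval[symmetric]
    by (rule integral_continuous_on_param, unfold split_def, rule continuous_on_compose2[OF cont])
       (auto intro!: continuous_intros simp: norm_mult)
  have h_nonneg: "0 \<le> h t" if "t \<in> {0..r}" for t
    unfolding h_def
  proof (rule Henstock_Kurzweil_Integration.integral_nonneg)
    show "(\<lambda>\<theta>. k (of_real t * cis \<theta>)) integrable_on {0..2*pi}"
      by (rule integrable_continuous_interval, rule continuous_on_compose2[OF cont])
        (use that in \<open>auto intro!: continuous_intros simp: norm_mult\<close>)
  qed (use that in \<open>auto intro!: nonneg simp: norm_mult\<close>)
  have inner: "(\<integral>\<^sup>+\<theta>. ennreal (K (cis \<theta> * z)) * indicator {0..2*pi} \<theta> \<partial>lborel)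
      = ennreal (h (cmod z)) * indicator (ball 0 r) z" for z
  proof (cases "cmod z < r")
    case True
    have c: "continuous_on {0..2*pi} (\<lambda>\<theta>. k (cis \<theta> * z))"
      by (rule continuous_on_compose2[OF cont]) (use True in \<open>auto intro!: continuous_intros simp: norm_mult\<close>)
    have "((\<lambda>\<theta>. K (cis \<theta> * z)) has_integral h (cmod z)) {0..2*pi}"
      using integrable_integral[OF integrable_continuous_interval[OF c]] True
      by (simp add: K_def norm_mult h_def circle_integral_radial[OF cont])
    then show ?thesis
      using True K_nonneg by (subst nn_integral_has_integral_lebesgue') auto
  qed (auto simp: K_def norm_mult)
  have "ennreal (2 * pi) * (\<integral>\<^sup>+z. K z \<partial>lborel)
      = (\<integral>\<^sup>+\<theta>. (\<integral>\<^sup>+z. K z \<partial>lborel) * indicator {0..2*pi} \<theta> \<partial>lborel)"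
    by (subst nn_integral_cmult_indicator) (auto simp: mult.commute)
  also have "\<dots> = (\<integral>\<^sup>+\<theta>. (\<integral>\<^sup>+z. K (cis \<theta> * z) \<partial>lborel) * indicator {0..2*pi} \<theta> \<partial>lborel)"
    using nn_integral_complex_rotation[of "\<lambda>z. ennreal (K z)" "cis _"] by simp
  also have "\<dots> = (\<integral>\<^sup>+\<theta>. (\<integral>\<^sup>+z. ennreal (K (cis \<theta> * z)) * indicator {0..2*pi} \<theta> \<partial>lborel) \<partial>lborel)"
    by (intro nn_integral_cong nn_integral_multc[symmetric]) measurable
  also have "\<dots> = (\<integral>\<^sup>+z. (\<integral>\<^sup>+\<theta>. ennreal (K (cis \<theta> * z)) * indicator {0..2*pi} \<theta> \<partial>lborel) \<partial>lborel)"
  proof (rule lborel_pair.Fubini')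
    have [measurable]: "(\<lambda>p::complex \<times> real. cis (snd p) * fst p) \<in> borel_measurable (lborel \<Otimes>\<^sub>M lborel)"
      unfolding lborel_prod by (auto intro!: borel_measurable_continuous_onI continuous_intros)
    show "(\<lambda>(z, \<theta>). ennreal (K (cis \<theta> * z)) * indicator {0..2*pi} \<theta>)
        \<in> borel_measurable (lborel \<Otimes>\<^sub>M lborel)"
      unfolding split_def by measurable
  qed
  also have "\<dots> = (\<integral>\<^sup>+z. ennreal (h (cmod z)) * indicator (ball 0 r) z \<partial>lborel)"
    unfolding inner ..
  also have "\<dots> = (\<integral>\<^sup>+z. ennreal (indicator {0..r} (cmod z) *\<^sub>R h (cmod z)) * indicator (ball 0 r) z \<partial>lborel)"
    by (intro nn_integral_cong) (auto simp: indicator_def)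
  also have "\<dots> = (\<integral>\<^sup>+z. ennreal (indicator {0..r} (cmod z) *\<^sub>R h (cmod z)) \<partial>restrict_space lborel (ball 0 r))"
    by (subst nn_integral_restrict_space) auto
  also have "\<dots> = (\<integral>\<^sup>+t. ennreal (indicator {0..r} t *\<^sub>R h t) \<partial>density lborel (\<lambda>t. ennreal (2 * pi * t) * indicator {0..r} t))"
  proof -
    have 1: "cmod \<in> restrict_space lborel (ball 0 r) \<rightarrow>\<^sub>M borel"
      by (rule measurable_restrict_space1) simp
    have 2: "(\<lambda>t. ennreal (indicator {0..r} t *\<^sub>R h t)) \<in> borel_measurable (distr (restrict_space lborel (ball (0::complex) r)) borel norm)"
      using borel_measurable_continuous_on_indicator[OF _ h_cont] by simp
    show ?thesis
      using nn_integral_distr[OF 1 2] by (simp add: distr_norm_lborel_disc[OF r])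
  qed
  also have "\<dots> = (\<integral>\<^sup>+t. ennreal (2 * pi * t) * indicator {0..r} t * ennreal (indicator {0..r} t *\<^sub>R h t) \<partial>lborel)"
    using borel_measurable_continuous_on_indicator[OF _ h_cont] by (subst nn_integral_density) auto
  also have "\<dots> = (\<integral>\<^sup>+t. ennreal (2 * pi * (t * h t)) * indicator {0..r} t \<partial>lborel)"
    using h_nonneg by (intro nn_integral_cong)
      (auto simp: indicator_def ennreal_mult'[symmetric] mult_ac)
  also have "\<dots> = ennreal (2 * pi * integral {0..r} (\<lambda>t. t * h t))"
  proof (rule nn_integral_has_integral_lebesgue')
    have "continuous_on {0..r} (\<lambda>t. t * h t)"
      by (intro continuous_intros h_cont)
    then show "((\<lambda>t. 2 * pi * (t * h t)) has_integral 2 * pi * integral {0..r} (\<lambda>t. t * h t)) {0..r}"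
      by (intro has_integral_mult_right integrable_integral integrable_continuous_interval)
  qed (use h_nonneg in auto)
  also have "\<dots> = ennreal (2 * pi) * ennreal (integral {0..r} (\<lambda>t. t * h t))"
    by (simp add: ennreal_mult')
  finally have "(\<integral>\<^sup>+z. K z \<partial>lborel) = ennreal (integral {0..r} (\<lambda>t. t * h t))"
    by (subst (asm) ennreal_mult_cancel_left) auto
  moreover have "0 \<le> integral {0..r} (\<lambda>t. t * h t)"
    using h_nonneg
    by (intro Henstock_Kurzweil_Integration.integral_nonneg integrable_continuous_interval
        continuous_intros h_cont) auto
  moreover have "integral\<^sup>L lborel K = enn2real (\<integral>\<^sup>+z. K z \<partial>lborel)"
    using K_nonneg by (intro integral_eq_nn_integral) auto
  ultimately show ?thesis
    by (simp add: set_lebesgue_integral_def K_def[abs_def] h_def)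
qed


section \<open>Radial derivatives of circle integrals\<close>

lemma cmod_square_has_real_derivative:
  assumes "(w has_vector_derivative w') (at t)"
  shows "((\<lambda>t. (cmod (w t))\<^sup>2) has_real_derivative 2 * Re (cnj (w t) * w')) (at t)"
proof -
  have d: "((\<lambda>t. Re (w t)) has_real_derivative Re w') (at t)"
       "((\<lambda>t. Im (w t)) has_real_derivative Im w') (at t)"
    using bounded_linear.has_vector_derivative[OF bounded_linear_Re assms]
          bounded_linear.has_vector_derivative[OF bounded_linear_Im assms]
    by (simp_all add: has_real_derivative_iff_has_vector_derivative)
  from DERIV_add[OF DERIV_power[OF d(1), of 2] DERIV_power[OF d(2), of 2]] show ?thesis
    unfolding cmod_power2 by (simp add: algebra_simps)
qed

lemma circle_path_has_vector_derivative:
  "((\<lambda>t. of_real t * cis \<theta>) has_vector_derivative cis \<theta>) (at t)"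
  "((\<lambda>\<theta>. of_real t * cis \<theta>) has_vector_derivative \<i> * (of_real t * cis \<theta>)) (at \<theta>)"
proof -
  show "((\<lambda>t. of_real t * cis \<theta>) has_vector_derivative cis \<theta>) (at t)"
    by (rule has_vector_derivative_eq_rhs)
       (rule has_vector_derivative_mult_left has_vector_derivative_of_real derivative_intros | simp)+
  have "((\<lambda>\<theta>. exp (\<i> * of_real \<theta>)) has_vector_derivative \<i> * exp (\<i> * of_real \<theta>)) (at \<theta>)"
    by (rule has_vector_derivative_real_field) (auto intro!: derivative_eq_intros)
  from has_vector_derivative_mult_right[OF this, of "of_real t"]
  show "((\<lambda>\<theta>. of_real t * cis \<theta>) has_vector_derivative \<i> * (of_real t * cis \<theta>)) (at \<theta>)"
    by (simp add: cis_conv_exp mult_ac)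
qed

text \<open>With \<open>g = z H' / H\<close> one has \<open>t \<partial>\<^sub>t log |H| = Re g\<close> and \<open>\<partial>\<^sub>\<theta> log |H| = - Im g\<close>. The last two
  formulas agree up to the factor \<open>t\<close>: this is the harmonicity of \<open>log |H|\<close> in logarithmic coordinates,
  and it lets the second radial derivative be integrated by parts around the circle.\<close>

lemma circle_derivatives:
  fixes H :: "complex \<Rightarrow> complex" and \<theta> t :: real
  assumes hol: "H holomorphic_on ball 0 1 - {0}" and t: "0 < t" "t < 1"
    and nz: "\<forall>z\<in>ball 0 1 - {0}. H z \<noteq> 0"
  defines "g \<equiv> \<lambda>z. z * deriv H z / H z" and "z \<equiv> of_real t * cis \<theta>"
  shows "((\<lambda>t. (cmod (H (of_real t * cis \<theta>)))\<^sup>2) has_real_derivative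
            2 * (cmod (H z))\<^sup>2 * Re (g z) / t) (at t)"
    and "((\<lambda>\<theta>. (cmod (H (of_real t * cis \<theta>)))\<^sup>2) has_real_derivative
            - 2 * (cmod (H z))\<^sup>2 * Im (g z)) (at \<theta>)"
    and "((\<lambda>t. Re (g (of_real t * cis \<theta>))) has_real_derivative Re (z * deriv g z) / t) (at t)"
    and "((\<lambda>\<theta>. Im (g (of_real t * cis \<theta>))) has_real_derivative Re (z * deriv g z)) (at \<theta>)"
proof -
  have S: "open (ball 0 1 - {0::complex})" by auto
  have zS: "z \<in> ball 0 1 - {0}"
    using t by (auto simp: z_def norm_mult)
  have g_hol: "g holomorphic_on ball 0 1 - {0}"
    unfolding g_def using hol nz S by (intro holomorphic_intros) auto
  have dH: "(H has_field_derivative deriv H z) (at z)" and dg: "(g has_field_derivative deriv g z) (at z)"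
    using hol g_hol S zS by (auto intro: holomorphic_derivI)
  note chain_t = field_vector_diff_chain_at[OF circle_path_has_vector_derivative(1), unfolded o_def]
  note chain_\<theta> = field_vector_diff_chain_at[OF circle_path_has_vector_derivative(2), unfolded o_def]
  have X: "cnj (H z) * (w * deriv H z) = of_real ((cmod (H z))\<^sup>2) * (w * deriv H z / H z)" for w
    using nz[rule_format, OF zS] complex_norm_square[of "H z"] by (simp add: field_simps)
  have cis: "cis \<theta> = z / of_real t"
    using t by (simp add: z_def)
  show "((\<lambda>t. (cmod (H (of_real t * cis \<theta>)))\<^sup>2) has_real_derivative
            2 * (cmod (H z))\<^sup>2 * Re (g z) / t) (at t)"
  proof -
    have "2 * Re (cnj (H z) * (cis \<theta> * deriv H z)) = 2 * (cmod (H z))\<^sup>2 * Re (g z) / t"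
    proof -
      have "cis \<theta> * deriv H z / H z = g z / of_real t"
        by (simp add: cis g_def)
      then show ?thesis
        unfolding X by (simp add: Re_divide_of_real)
    qed
    then show ?thesis
      using cmod_square_has_real_derivative[OF chain_t[of H "deriv H z" t \<theta>]] dH
      by (simp add: z_def)
  qed
  show "((\<lambda>\<theta>. (cmod (H (of_real t * cis \<theta>)))\<^sup>2) has_real_derivative
            - 2 * (cmod (H z))\<^sup>2 * Im (g z)) (at \<theta>)"
  proof -
    have "2 * Re (cnj (H z) * (\<i> * z * deriv H z)) = - 2 * (cmod (H z))\<^sup>2 * Im (g z)"
    proof -
      have "\<i> * z * deriv H z / H z = \<i> * g z"
        by (simp add: g_def)
      then show ?thesis
        unfolding X by simp
    qed
    then show ?thesis
      using cmod_square_has_real_derivative[OF chain_\<theta>[of H "deriv H z" t \<theta>]] dH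
      by (simp add: z_def)
  qed
  show "((\<lambda>t. Re (g (of_real t * cis \<theta>))) has_real_derivative Re (z * deriv g z) / t) (at t)"
  proof -
    have "Re (cis \<theta> * deriv g z) = Re (z * deriv g z) / t"
      unfolding cis by (simp add: Re_divide_of_real)
    then show ?thesis
      using bounded_linear.has_vector_derivative[OF bounded_linear_Re chain_t[of g "deriv g z" t \<theta>]] dg
      by (simp add: z_def has_real_derivative_iff_has_vector_derivative)
  qed
  show "((\<lambda>\<theta>. Im (g (of_real t * cis \<theta>))) has_real_derivative Re (z * deriv g z)) (at \<theta>)"
  proof -
    have "Im (\<i> * z * deriv g z) = Re (z * deriv g z)"
      by simp
    then show ?thesis
      using bounded_linear.has_vector_derivative[OF bounded_linear_Im chain_\<theta>[of g "deriv g z" t \<theta>]] dg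
      by (simp add: z_def has_real_derivative_iff_has_vector_derivative)
  qed
qed

lemma circle_leibniz:
  fixes q q' :: "complex \<Rightarrow> real"
  assumes deriv: "\<And>t \<theta>. 0 < t \<Longrightarrow> t < 1 \<Longrightarrow>
      ((\<lambda>t. q (of_real t * cis \<theta>)) has_real_derivative q' (of_real t * cis \<theta>)) (at t)"
    and cont: "continuous_on (ball 0 1 - {0}) q" "continuous_on (ball 0 1 - {0}) q'"
    and t: "0 < t" "t < 1"
  shows "((\<lambda>t. integral {0..2*pi} (\<lambda>\<theta>. q (of_real t * cis \<theta>))) has_real_derivative
      integral {0..2*pi} (\<lambda>\<theta>. q' (of_real t * cis \<theta>))) (at t)"
proof -
  have "((\<lambda>t. integral (cbox 0 (2*pi)) (\<lambda>\<theta>. q (of_real t * cis \<theta>))) has_real_derivative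
      integral (cbox 0 (2*pi)) (\<lambda>\<theta>. q' (of_real t * cis \<theta>))) (at t within {0<..<1})"
  proof (rule leibniz_rule_field_derivative)
    show "(\<lambda>\<theta>. q (of_real x * cis \<theta>)) integrable_on cbox 0 (2*pi)" if "x \<in> {0<..<1}" for x
      by (rule integrable_continuous, rule continuous_on_compose2[OF cont(1)])
        (use that in \<open>auto intro!: continuous_intros simp: norm_mult\<close>)
    show "continuous_on ({0<..<1} \<times> cbox 0 (2*pi)) (\<lambda>(x, \<theta>). q' (of_real x * cis \<theta>))"
      unfolding split_def
      by (rule continuous_on_compose2[OF cont(2)]) (auto intro!: continuous_intros simp: norm_mult)
  qed (use deriv t in \<open>auto intro: has_field_derivative_at_within\<close>)
  then show ?thesis
    using t by (simp add: at_within_open[of t "{0<..<1}"])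
qed

lemma circle_mean_has_derivative:
  fixes H :: "complex \<Rightarrow> complex" and \<psi> \<psi>' :: "real \<Rightarrow> real"
  assumes hol: "H holomorphic_on ball 0 1 - {0}"
    and nz: "\<forall>z\<in>ball 0 1 - {0}. H z \<noteq> 0"
    and \<psi>: "\<And>x. 0 < x \<Longrightarrow> (\<psi> has_real_derivative \<psi>' x) (at x)" "continuous_on {0<..} \<psi>'"
    and t: "0 < t" "t < 1"
  defines "g \<equiv> \<lambda>z. z * deriv H z / H z" and "X \<equiv> \<lambda>z. (cmod (H z))\<^sup>2"
  shows "((\<lambda>t. integral {0..2*pi} (\<lambda>\<theta>. \<psi> (X (of_real t * cis \<theta>)))) has_real_derivative
      integral {0..2*pi} (\<lambda>\<theta>. 2 * X (of_real t * cis \<theta>) * \<psi>' (X (of_real t * cis \<theta>))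
                             * Re (g (of_real t * cis \<theta>))) / t) (at t)"
proof -
  have X_pos: "0 < X z" if "z \<in> ball 0 1 - {0}" for z
    using nz[rule_format, OF that] by (simp add: X_def)
  have g_cont: "continuous_on (ball 0 1 - {0}) g"
    unfolding g_def using hol nz
    by (intro holomorphic_on_imp_continuous_on holomorphic_intros) auto
  have X_cont: "continuous_on (ball 0 1 - {0}) X"
    unfolding X_def using hol by (intro continuous_intros holomorphic_on_imp_continuous_on)
  have \<psi>_cont: "continuous_on {0<..} \<psi>"
    using \<psi>(1) by (intro continuous_at_imp_continuous_on) (auto intro: DERIV_isCont)
  have \<psi>X_cont: "continuous_on (ball 0 1 - {0}) (\<lambda>z. \<psi> (X z))"
    "continuous_on (ball 0 1 - {0}) (\<lambda>z. \<psi>' (X z))"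
    by (rule continuous_on_compose2[OF \<psi>_cont X_cont] continuous_on_compose2[OF \<psi>(2) X_cont];
        use X_pos in fastforce)+
  have norm: "cmod (of_real s * cis \<theta>) = s" if "0 < s" for s \<theta>
    using that by (simp add: norm_mult)
  have "((\<lambda>t. integral {0..2*pi} (\<lambda>\<theta>. \<psi> (X (of_real t * cis \<theta>)))) has_real_derivative
      integral {0..2*pi} (\<lambda>\<theta>. 2 * X (of_real t * cis \<theta>) * \<psi>' (X (of_real t * cis \<theta>))
                             * Re (g (of_real t * cis \<theta>)) / cmod (of_real t * cis \<theta>))) (at t)"
  proof (rule circle_leibniz)
    fix s \<theta> :: real assume s: "0 < s" "s < 1"
    have S: "of_real s * cis \<theta> \<in> ball 0 1 - {0}"
      using s by (simp add: norm_mult)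
    have dX: "((\<lambda>t. X (of_real t * cis \<theta>)) has_real_derivative
        2 * X (of_real s * cis \<theta>) * Re (g (of_real s * cis \<theta>)) / s) (at s)"
      using circle_derivatives(1)[OF hol s nz, of \<theta>] by (simp add: X_def g_def)
    from DERIV_chain2[OF \<psi>(1)[OF X_pos[OF S]] dX]
    show "((\<lambda>t. \<psi> (X (of_real t * cis \<theta>))) has_real_derivative
        2 * X (of_real s * cis \<theta>) * \<psi>' (X (of_real s * cis \<theta>))
          * Re (g (of_real s * cis \<theta>)) / cmod (of_real s * cis \<theta>)) (at s)"
      unfolding norm[OF s(1)] by (simp add: mult_ac)
  qed (use t in \<open>auto intro!: continuous_intros \<psi>X_cont X_cont g_cont\<close>)
  then show ?thesis
    unfolding norm[OF t(1)] by simp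
qed

text \<open>A one-dimensional form of Green's identity. Differentiating under the integral gives
  \<open>2 X \<phi>'(X) (Re g)\<^sup>2 + \<phi>(X) Re (z g')\<close> over \<open>t\<close>. The function \<open>\<phi>(X) Im g\<close> is periodic in \<open>\<theta>\<close>, so its
  \<open>\<theta>\<close>-derivative \<open>\<phi>(X) Re (z g') - 2 X \<phi>'(X) (Im g)\<^sup>2\<close> has integral zero; subtracting it removes \<open>g'\<close>
  and completes the square to \<open>|g|\<^sup>2\<close>.\<close>

lemma circle_energy_has_derivative:
  fixes H :: "complex \<Rightarrow> complex" and \<phi> \<phi>' :: "real \<Rightarrow> real"
  assumes hol: "H holomorphic_on ball 0 1 - {0}"
    and nz: "\<forall>z\<in>ball 0 1 - {0}. H z \<noteq> 0"
    and \<phi>: "\<And>x. 0 < x \<Longrightarrow> (\<phi> has_real_derivative \<phi>' x) (at x)" "continuous_on {0<..} \<phi>'"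
    and t: "0 < t" "t < 1"
  defines "g \<equiv> \<lambda>z. z * deriv H z / H z" and "X \<equiv> \<lambda>z. (cmod (H z))\<^sup>2"
  shows "((\<lambda>t. integral {0..2*pi} (\<lambda>\<theta>. \<phi> (X (of_real t * cis \<theta>)) * Re (g (of_real t * cis \<theta>))))
      has_real_derivative
      integral {0..2*pi} (\<lambda>\<theta>. 2 * X (of_real t * cis \<theta>) * \<phi>' (X (of_real t * cis \<theta>))
                             * (cmod (g (of_real t * cis \<theta>)))\<^sup>2) / t) (at t)"
proof -
  have X_pos: "0 < X z" if "z \<in> ball 0 1 - {0}" for z
    using nz[rule_format, OF that] by (simp add: X_def)
  have g_hol: "g holomorphic_on ball 0 1 - {0}"
    unfolding g_def using hol nz by (intro holomorphic_intros) auto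
  then have g_cont: "continuous_on (ball 0 1 - {0}) g" "continuous_on (ball 0 1 - {0}) (deriv g)"
    by (auto intro!: holomorphic_on_imp_continuous_on holomorphic_deriv)
  have X_cont: "continuous_on (ball 0 1 - {0}) X"
    unfolding X_def using hol by (intro continuous_intros holomorphic_on_imp_continuous_on)
  have \<phi>_cont: "continuous_on {0<..} \<phi>"
    using \<phi>(1) by (intro continuous_at_imp_continuous_on) (auto intro: DERIV_isCont)
  have \<phi>X_cont: "continuous_on (ball 0 1 - {0}) (\<lambda>z. \<phi> (X z))"
    "continuous_on (ball 0 1 - {0}) (\<lambda>z. \<phi>' (X z))"
    by (rule continuous_on_compose2[OF \<phi>_cont X_cont] continuous_on_compose2[OF \<phi>(2) X_cont];
        use X_pos in fastforce)+
  have S: "of_real s * cis \<theta> \<in> ball 0 1 - {0}" if "0 < s" "s < 1" for s \<theta>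
    using that by (simp add: norm_mult)
  have norm: "cmod (of_real s * cis \<theta>) = s" if "0 < s" for s \<theta>
    using that by (simp add: norm_mult)
  \<comment> \<open>\<open>u / t\<close> is the radial derivative of the integrand and \<open>v\<close> the angular derivative of \<open>\<phi>(X) Im g\<close>.\<close>
  define u where "u z = 2 * X z * \<phi>' (X z) * (Re (g z))\<^sup>2 + \<phi> (X z) * Re (z * deriv g z)" for z
  define v where "v z = \<phi> (X z) * Re (z * deriv g z) - 2 * X z * \<phi>' (X z) * (Im (g z))\<^sup>2" for z
  have uv_cont: "continuous_on (ball 0 1 - {0}) u" "continuous_on (ball 0 1 - {0}) v"
    unfolding u_def v_def by (auto intro!: continuous_intros \<phi>X_cont X_cont g_cont)
  have int: "(\<lambda>\<theta>. w (of_real t * cis \<theta>)) integrable_on {0..2*pi}"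
    if "continuous_on (ball 0 1 - {0}) w" for w :: "complex \<Rightarrow> real"
    by (rule integrable_continuous_interval, rule continuous_on_compose2[OF that])
      (use t in \<open>auto intro!: continuous_intros simp: norm_mult\<close>)
  have "((\<lambda>t. integral {0..2*pi} (\<lambda>\<theta>. \<phi> (X (of_real t * cis \<theta>)) * Re (g (of_real t * cis \<theta>))))
      has_real_derivative integral {0..2*pi} (\<lambda>\<theta>. u (of_real t * cis \<theta>) / cmod (of_real t * cis \<theta>))) (at t)"
  proof (rule circle_leibniz)
    fix s \<theta> :: real assume s: "0 < s" "s < 1"
    have dX: "((\<lambda>t. X (of_real t * cis \<theta>)) has_real_derivative
        2 * X (of_real s * cis \<theta>) * Re (g (of_real s * cis \<theta>)) / s) (at s)"
      using circle_derivatives(1)[OF hol s nz, of \<theta>] by (simp add: X_def g_def)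
    have dg: "((\<lambda>t. Re (g (of_real t * cis \<theta>))) has_real_derivative
        Re (of_real s * cis \<theta> * deriv g (of_real s * cis \<theta>)) / s) (at s)"
      using circle_derivatives(3)[OF hol s nz, of \<theta>] unfolding g_def .
    from DERIV_mult[OF DERIV_chain2[OF \<phi>(1)[OF X_pos[OF S[OF s, of \<theta>]]] dX] dg]
    show "((\<lambda>t. \<phi> (X (of_real t * cis \<theta>)) * Re (g (of_real t * cis \<theta>))) has_real_derivative
        u (of_real s * cis \<theta>) / cmod (of_real s * cis \<theta>)) (at s)"
      unfolding norm[OF s(1)] u_def using s
      by (simp add: field_simps power2_eq_square)
  qed (use t in \<open>auto intro!: continuous_intros \<phi>X_cont X_cont g_cont uv_cont\<close>)
  moreover have "((\<lambda>\<theta>. v (of_real t * cis \<theta>)) has_integral 0) {0..2*pi}"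
  proof -
    have "((\<lambda>\<theta>. v (of_real t * cis \<theta>)) has_integral
        \<phi> (X (of_real t * cis (2*pi))) * Im (g (of_real t * cis (2*pi)))
        - \<phi> (X (of_real t * cis 0)) * Im (g (of_real t * cis 0))) {0..2*pi}"
    proof (rule fundamental_theorem_of_calculus)
      fix \<theta> :: real
      have dX: "((\<lambda>\<theta>. X (of_real t * cis \<theta>)) has_real_derivative
          - 2 * X (of_real t * cis \<theta>) * Im (g (of_real t * cis \<theta>))) (at \<theta>)"
        using circle_derivatives(2)[OF hol t nz, of \<theta>] by (simp add: X_def g_def)
      have dg: "((\<lambda>\<theta>. Im (g (of_real t * cis \<theta>))) has_real_derivative
          Re (of_real t * cis \<theta> * deriv g (of_real t * cis \<theta>))) (at \<theta>)"
        using circle_derivatives(4)[OF hol t nz, of \<theta>] unfolding g_def .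
      from DERIV_mult[OF DERIV_chain2[OF \<phi>(1)[OF X_pos[OF S[OF t, of \<theta>]]] dX] dg]
      have "((\<lambda>\<theta>. \<phi> (X (of_real t * cis \<theta>)) * Im (g (of_real t * cis \<theta>))) has_real_derivative
          v (of_real t * cis \<theta>)) (at \<theta>)"
        unfolding v_def by (simp add: algebra_simps power2_eq_square)
      then show "((\<lambda>\<theta>. \<phi> (X (of_real t * cis \<theta>)) * Im (g (of_real t * cis \<theta>))) has_vector_derivative
          v (of_real t * cis \<theta>)) (at \<theta> within {0..2*pi})"
        by (simp add: has_real_derivative_iff_has_vector_derivative has_vector_derivative_at_within)
    qed simp
    then show ?thesis
      by simp
  qed
  moreover have "integral {0..2*pi} (\<lambda>\<theta>. u (of_real t * cis \<theta>)) - integral {0..2*pi} (\<lambda>\<theta>. v (of_real t * cis \<theta>))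
      = integral {0..2*pi} (\<lambda>\<theta>. 2 * X (of_real t * cis \<theta>) * \<phi>' (X (of_real t * cis \<theta>))
                             * (cmod (g (of_real t * cis \<theta>)))\<^sup>2)"
    unfolding integral_diff[OF int[OF uv_cont(1)] int[OF uv_cont(2)], symmetric]
    by (simp add: u_def v_def cmod_power2 algebra_simps)
  ultimately show ?thesis
    unfolding norm[OF t(1)] by (simp add: integral_unique)
qed


section \<open>Spherical area of the image of a disc\<close>

lemma integral_circle_continuous_on:
  fixes w :: "complex \<Rightarrow> real \<Rightarrow> real"
  assumes "continuous_on (ball 0 1 \<times> UNIV) (\<lambda>(z, \<theta>). w z \<theta>)"
  shows "continuous_on {0..<1} (\<lambda>t. integral {0..2*pi} (\<lambda>\<theta>. w (of_real t * cis \<theta>) \<theta>))"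
proof -
  have "continuous_on ({0..<1} \<times> cbox 0 (2*pi)) (\<lambda>(t, \<theta>). w (of_real t * cis \<theta>) \<theta>)"
    using continuous_on_compose2[OF assms, of "{0..<1} \<times> cbox 0 (2*pi)" "\<lambda>p. (of_real (fst p) * cis (snd p), snd p)"]
    by (force intro!: continuous_intros simp: split_def norm_mult)
  from integral_continuous_on_param[OF this] show ?thesis
    by simp
qed

text \<open>The area form of the sphere has the primitive \<open>|w|\<^sup>2 / (1 + |w|\<^sup>2) d(arg w) / 2\<close>, so this is Stokes'
  theorem pulled back by \<open>F\<close>: on a circle, \<open>d(arg F) = Re (z F' / F) d\<theta>\<close>, and \<open>z F' / F = 1 + z G' / G\<close>.
  It is proved by comparing radial derivatives, that of the circle integral being given by
  \<open>circle_energy_has_derivative\<close> with \<open>\<phi> x = x / (1 + x)\<close>.\<close>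

lemma spherical_area_eq_circle_integral:
  assumes G: "G holomorphic_on ball 0 1" and nz: "\<forall>z\<in>ball 0 1. G z \<noteq> 0"
    and r: "0 < r" "r < 1"
  defines "F \<equiv> \<lambda>z. z * G z"
  shows "(LINT z:ball 0 r|lborel. (finite_sph_deriv F z)\<^sup>2)
       = integral {0..2*pi} (\<lambda>\<theta>. (cmod (F (of_real r * cis \<theta>)))\<^sup>2 / (1 + (cmod (F (of_real r * cis \<theta>)))\<^sup>2)
           * (1 + Re (of_real r * cis \<theta> * deriv G (of_real r * cis \<theta>) / G (of_real r * cis \<theta>)))) / 2"
proof -
  define L where "L z = z * deriv G z / G z" for z
  define c where "c z = (cmod (F z))\<^sup>2 / (1 + (cmod (F z))\<^sup>2) * (1 + Re (L z))" for z
  define C where "C t = integral {0..2*pi} (\<lambda>\<theta>. c (of_real t * cis \<theta>))" for t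
  define h where "h t = integral {0..2*pi} (\<lambda>\<theta>. (finite_sph_deriv F (of_real t * cis \<theta>))\<^sup>2)" for t
  have F_hol: "F holomorphic_on ball 0 1"
    unfolding F_def using G by (intro holomorphic_intros)
  have pos: "1 + (cmod w)\<^sup>2 \<noteq> 0" for w :: complex
    by (metis add_pos_nonneg less_numeral_extra(1) less_numeral_extra(3) zero_le_power2)
  have sph_cont: "continuous_on (ball 0 1) (\<lambda>z. (finite_sph_deriv F z)\<^sup>2)"
    unfolding finite_sph_deriv_def using F_hol pos
    by (intro continuous_intros holomorphic_on_imp_continuous_on holomorphic_deriv) auto
  have L_cont: "continuous_on (ball 0 1) L"
    unfolding L_def using G nz by (intro holomorphic_on_imp_continuous_on holomorphic_intros) auto
  have c_cont: "continuous_on (ball 0 1) c"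
    unfolding c_def using pos
    by (intro continuous_intros L_cont holomorphic_on_imp_continuous_on[OF F_hol]) auto
  have C_cont: "continuous_on {0..<1} C"
    unfolding C_def
    by (rule integral_circle_continuous_on[where w = "\<lambda>z _. c z", unfolded split_def],
        rule continuous_on_compose2[OF c_cont]) (auto intro: continuous_intros)
  have F_log: "z * deriv F z / F z = 1 + L z" if "z \<in> ball 0 1 - {0}" for z
  proof -
    have "deriv F z = G z + z * deriv G z"
      unfolding F_def using that
      by (intro DERIV_imp_deriv) (auto intro!: derivative_eq_intros holomorphic_derivI[OF G])
    then show ?thesis
      using that nz by (simp add: F_def L_def field_simps)
  qed
  have F_nz: "\<forall>z\<in>ball 0 1 - {0}. F z \<noteq> 0"
    using nz by (auto simp: F_def)
  have C_deriv: "(C has_real_derivative 2 * (t * h t)) (at t)" if t: "0 < t" "t < 1" for t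
  proof -
    have S: "of_real s * cis \<theta> \<in> ball 0 1 - {0}" if "s \<in> {0<..<1}" for s \<theta>
      using that by (simp add: norm_mult)
    have F_hol': "F holomorphic_on ball 0 1 - {0}"
      using F_hol by (rule holomorphic_on_subset) auto
    have d: "((\<lambda>x. x / (1 + x)) has_real_derivative 1 / (1 + x)\<^sup>2) (at x)" if "0 < x" for x :: real
      using that by (auto intro!: derivative_eq_intros simp: field_simps power2_eq_square)
    have d_cont: "continuous_on {0<..} (\<lambda>x::real. 1 / (1 + x)\<^sup>2)"
      by (intro continuous_intros) auto
    have "((\<lambda>t. integral {0..2*pi} (\<lambda>\<theta>. (cmod (F (of_real t * cis \<theta>)))\<^sup>2 / (1 + (cmod (F (of_real t * cis \<theta>)))\<^sup>2)
            * Re (of_real t * cis \<theta> * deriv F (of_real t * cis \<theta>) / F (of_real t * cis \<theta>))))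
        has_real_derivative
        integral {0..2*pi} (\<lambda>\<theta>. 2 * (cmod (F (of_real t * cis \<theta>)))\<^sup>2 * (1 / (1 + (cmod (F (of_real t * cis \<theta>)))\<^sup>2)\<^sup>2)
            * (cmod (of_real t * cis \<theta> * deriv F (of_real t * cis \<theta>) / F (of_real t * cis \<theta>)))\<^sup>2) / t) (at t)"
      by (rule circle_energy_has_derivative[OF F_hol' F_nz d d_cont t])
    also have "integral {0..2*pi} (\<lambda>\<theta>. 2 * (cmod (F (of_real t * cis \<theta>)))\<^sup>2 * (1 / (1 + (cmod (F (of_real t * cis \<theta>)))\<^sup>2)\<^sup>2)
            * (cmod (of_real t * cis \<theta> * deriv F (of_real t * cis \<theta>) / F (of_real t * cis \<theta>)))\<^sup>2) / t
        = integral {0..2*pi} (\<lambda>\<theta>. 2 * t\<^sup>2 * (finite_sph_deriv F (of_real t * cis \<theta>))\<^sup>2) / t"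
      using F_nz S t
      by (intro arg_cong[where f = "\<lambda>x. x / t"] Henstock_Kurzweil_Integration.integral_cong)
         (simp add: finite_sph_deriv_def norm_mult norm_divide power_mult_distrib power_divide)
    also have "\<dots> = 2 * (t * h t)"
      using t by (simp add: h_def power2_eq_square)
    finally show ?thesis
    proof (rule has_field_derivative_transform_within_open)
      fix s :: real assume s: "s \<in> {0<..<1}"
      show "integral {0..2*pi} (\<lambda>\<theta>. (cmod (F (of_real s * cis \<theta>)))\<^sup>2 / (1 + (cmod (F (of_real s * cis \<theta>)))\<^sup>2)
            * Re (of_real s * cis \<theta> * deriv F (of_real s * cis \<theta>) / F (of_real s * cis \<theta>))) = C s"
        unfolding C_def c_def F_log[OF S[OF s]] by simp
    qed (use t in auto)
  qed
  have "((\<lambda>t. t * h t) has_integral C r / 2 - C 0 / 2) {0..r}"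
  proof (rule fundamental_theorem_of_calculus_interior)
    show "continuous_on {0..r} (\<lambda>t. C t / 2)"
      using r by (intro continuous_intros continuous_on_subset[OF C_cont]) auto
    fix t assume "t \<in> {0<..<r}"
    with r have "((\<lambda>t. C t / 2) has_real_derivative 2 * (t * h t) / 2) (at t)"
      by (intro DERIV_cdivide C_deriv) auto
    then show "((\<lambda>t. C t / 2) has_vector_derivative t * h t) (at t)"
      by (simp add: has_real_derivative_iff_has_vector_derivative)
  qed (use r in simp)
  moreover have "C 0 = 0"
    by (simp add: C_def c_def F_def)
  ultimately have "integral {0..r} (\<lambda>t. t * h t) = C r / 2"
    by (simp add: integral_unique)
  then show ?thesis
    using integral_disc_polar[OF r(1), of "\<lambda>z. (finite_sph_deriv F z)\<^sup>2"] r
      continuous_on_subset[OF sph_cont, of "cball 0 r"]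
    by (simp add: h_def C_def c_def L_def cball_subset_ball_iff)
qed

text \<open>For \<open>x \<le> 1\<close> both summands are nonnegative. For \<open>x > 1\<close> one has \<open>2 ln (r / t) \<le> ln (1 / t\<^sup>2) \<le> 1 / t\<^sup>2 - 1\<close>, while
  \<open>(x - 1) / (x + 1) \<le> t\<^sup>2\<close>, and the product of the two bounds is less than one.\<close>

lemma green_weight_nonneg:
  fixes r t x :: real
  assumes t: "0 < t" "t < r" and r: "r < 1" and x: "0 \<le> x" "x * (1 - t\<^sup>2) \<le> 1"
  shows "0 \<le> 1 + 2 * ln (r / t) * ((1 - x) / (1 + x))"
proof (cases "x \<le> 1")
  case True
  then show ?thesis
    using t x(1) by simp
next
  case False
  have "2 * ln (r / t) \<le> 2 * ln (1 / t)"
    using t r by (simp add: ln_div)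
  also have "\<dots> = ln ((1 / t)\<^sup>2)"
    using t by (simp add: ln_realpow)
  also have "\<dots> \<le> (1 / t)\<^sup>2 - 1"
    using t by (intro ln_le_minus_one) simp
  finally have 1: "2 * ln (r / t) \<le> (1 / t)\<^sup>2 - 1" .
  have 2: "(x - 1) / (1 + x) \<le> t\<^sup>2"
    using x False by (simp add: field_simps) (use zero_le_power2[of t] in linarith)
  have "2 * ln (r / t) * ((x - 1) / (1 + x)) \<le> ((1 / t)\<^sup>2 - 1) * t\<^sup>2"
    using 1 2 False t r one_le_power[of "1 / t" 2] by (intro mult_mono) (auto simp: ln_ge_zero)
  also have "\<dots> \<le> 1"
    using t by (simp add: algebra_simps power_divide)
  finally show ?thesis
    by (simp add: algebra_simps diff_divide_distrib)
qed

text \<open>The right side collects the contributions of \<open>2 x / (1 + x)\<^sup>2\<close> and \<open>x / (1 + x)\<close>, through their derivatives,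
  to the slope of \<open>Q\<close> in \<open>spherical_area_lower_bound\<close>; the factor of \<open>green_weight_nonneg\<close> splits off, with
  \<open>c = ln (r / t)\<close>.\<close>

lemma green_weight_eq:
  fixes a c x l :: real
  shows "2 * x / (1 + x)\<^sup>2 * l * (1 + 2 * c * ((1 - x) / (1 + x)))
       = c * (2 * x * (2 * (1 - x) / (1 + x) ^ 3) * l) + 2 * x * (1 / (1 + x)\<^sup>2) * l"
proof -
  have "2 * x / a\<^sup>2 * l * (1 + 2 * c * (b / a)) = c * (2 * x * (2 * b / a ^ 3) * l) + 2 * x * (1 / a\<^sup>2) * l"
    for a b :: real
    by (simp add: divide_inverse power2_eq_square power3_eq_cube ring_distribs mult_ac)
  then show ?thesis
    by this
qed

lemma continuous_on_times_ln_inverse: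
  assumes "0 < r"
  shows "continuous_on {0..r} (\<lambda>t::real. t * ln (r / t))"
  unfolding continuous_on_def
proof
  fix t assume t: "t \<in> {0..r}"
  show "((\<lambda>t. t * ln (r / t)) \<longlongrightarrow> t * ln (r / t)) (at t within {0..r})"
  proof (cases "t = 0")
    case True
    have "((\<lambda>t. t * ln (r / t)) \<longlongrightarrow> 0) (at 0 within {0..r})"
    proof (rule tendsto_sandwich[where f = "\<lambda>_. 0" and h = "\<lambda>t. 2 * sqrt (r * t)"])
      show "((\<lambda>t. 2 * sqrt (r * t)) \<longlongrightarrow> 0) (at 0 within {0..r})"
        by (auto intro!: tendsto_eq_intros)
      have *: "0 \<le> s * ln (r / s) \<and> s * ln (r / s) \<le> 2 * sqrt (r * s)" if s: "s \<in> {0..r}" "s \<noteq> 0" for s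
      proof
        show "0 \<le> s * ln (r / s)"
          using s by (intro mult_nonneg_nonneg ln_ge_zero) auto
        have "s * ln (r / s) = s * (2 * ln (sqrt (r / s)))"
          using s assms by (simp add: ln_sqrt)
        also have "\<dots> \<le> s * (2 * sqrt (r / s))"
          using s assms by (intro mult_left_mono) (auto intro: order.trans[OF ln_le_minus_one])
        also have "\<dots> = 2 * sqrt (r * s)"
          using s assms by (simp add: real_sqrt_divide real_sqrt_mult real_div_sqrt field_simps)
        finally show "s * ln (r / s) \<le> 2 * sqrt (r * s)" .
      qed
      show "\<forall>\<^sub>F s in at 0 within {0..r}. 0 \<le> s * ln (r / s)"
        "\<forall>\<^sub>F s in at 0 within {0..r}. s * ln (r / s) \<le> 2 * sqrt (r * s)"
        using * by (auto simp: eventually_at intro!: exI[of _ 1])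
    qed simp
    then show ?thesis
      using True by simp
  qed (use t assms in \<open>auto intro!: tendsto_intros\<close>)
qed

text \<open>Let \<open>p = log |r G|\<close>, a harmonic function, and \<open>\<Phi>(s) = e\<^bsup>2s\<^esup> / (1 + e\<^bsup>2s\<^esup>)\<close>. By the circle formula twice the
  area is \<open>N(r) + D(r)\<close>, where \<open>N\<close> is the circle integral of \<open>\<Phi>(p)\<close> and \<open>D\<close> that of \<open>\<Phi>(p) t \<partial>\<^sub>t p\<close>, while
  \<open>N(0)\<close> is twice the claimed bound. If \<open>\<Phi>\<close> were convex, \<open>N\<close> and \<open>D\<close> would both increase. It is convex only
  for \<open>s \<le> 0\<close>, but the loss in \<open>N\<close> is compensated by the gain in \<open>D\<close>: with \<open>K = t N'\<close>, the function
  \<open>Q = ln (r / t) K + N + D\<close> interpolates between \<open>N(0)\<close> and \<open>N(r) + D(r)\<close>, and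
  \<open>t Q' = ln (r / t) t K' + t D'\<close>. Here \<open>t D'\<close> and \<open>t K'\<close> are circle integrals of \<open>\<Phi>'(p) |\<nabla>p|\<^sup>2\<close> and
  \<open>\<Phi>''(p) |\<nabla>p|\<^sup>2\<close>, the gradient being taken in logarithmic coordinates, so the sign of \<open>Q'\<close> is that of the
  weight in \<open>green_weight_nonneg\<close>. The growth hypothesis supplies the bound that this weight requires.\<close>

lemma spherical_area_lower_bound:
  assumes G: "G holomorphic_on ball 0 1" and nz: "\<forall>z\<in>ball 0 1. G z \<noteq> 0"
    and growth: "\<forall>z\<in>ball 0 1. (cmod (G z))\<^sup>2 * (1 - (cmod z)\<^sup>2) \<le> 1"
    and r: "0 < r" "r < 1"
  shows "(LINT z:ball 0 r|lborel. (finite_sph_deriv (\<lambda>z. z * G z) z)\<^sup>2)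
       \<ge> pi * (r\<^sup>2 * (cmod (G 0))\<^sup>2 / (1 + r\<^sup>2 * (cmod (G 0))\<^sup>2))"
proof -
  define L where "L z = z * deriv G z / G z" for z
  define H where "H z = of_real r * G z" for z
  define X where "X z = (cmod (H z))\<^sup>2" for z
  define \<phi> \<phi>' \<kappa> \<kappa>' :: "real \<Rightarrow> real"
    where "\<phi> x = x / (1 + x)" and "\<phi>' x = 1 / (1 + x)\<^sup>2"
      and "\<kappa> x = 2 * x / (1 + x)\<^sup>2" and "\<kappa>' x = 2 * (1 - x) / (1 + x) ^ 3" for x
  define N where "N t = integral {0..2*pi} (\<lambda>\<theta>. \<phi> (X (of_real t * cis \<theta>)))" for t
  define D where "D t = integral {0..2*pi} (\<lambda>\<theta>. \<phi> (X (of_real t * cis \<theta>)) * Re (L (of_real t * cis \<theta>)))" for t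
  define K where "K t = integral {0..2*pi} (\<lambda>\<theta>. \<kappa> (X (of_real t * cis \<theta>)) * Re (L (of_real t * cis \<theta>)))" for t
  \<comment> \<open>\<open>K = t k\<close>, with \<open>k\<close> continuous at \<open>0\<close>; so \<open>Q\<close> below, equal to \<open>ln (r / t) K + N + D\<close>, is continuous at \<open>0\<close>.\<close>
  define k where "k t = integral {0..2*pi} (\<lambda>\<theta>. \<kappa> (X (of_real t * cis \<theta>))
      * Re (cis \<theta> * (deriv G (of_real t * cis \<theta>) / G (of_real t * cis \<theta>))))" for t
  define Q where "Q t = t * ln (r / t) * k t + N t + D t" for t

  have X_eq: "X z = r\<^sup>2 * (cmod (G z))\<^sup>2" for z
    using r by (simp add: X_def H_def norm_mult power_mult_distrib)
  have X_nonneg: "0 \<le> X z" for z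
    by (simp add: X_def)
  have pos: "1 + X z \<noteq> 0" for z
    using X_nonneg[of z] by linarith
  have hol: "H holomorphic_on ball 0 1 - {0}"
    unfolding H_def using holomorphic_on_subset[OF G, of "ball 0 1 - {0}"]
    by (intro holomorphic_intros) auto
  have H_nz: "\<forall>z\<in>ball 0 1 - {0}. H z \<noteq> 0"
    using nz r by (auto simp: H_def)
  have H_log: "z * deriv H z / H z = L z" if "z \<in> ball 0 1" for z
  proof -
    have "deriv H z = of_real r * deriv G z"
      unfolding H_def using holomorphic_on_imp_differentiable_at[OF G _ that] by simp
    then show ?thesis
      using r by (simp add: H_def L_def)
  qed
  have inB: "of_real s * cis \<theta> \<in> ball 0 1" if "0 < s" "s < 1" for s \<theta>
    using that by (simp add: norm_mult)
  have \<phi>_deriv: "(\<phi> has_real_derivative \<phi>' x) (at x)" and \<kappa>_deriv: "(\<kappa> has_real_derivative \<kappa>' x) (at x)"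
    if "0 < x" for x
  proof -
    show "(\<phi> has_real_derivative \<phi>' x) (at x)"
      unfolding \<phi>_def[abs_def] \<phi>'_def using that
      by (auto intro!: derivative_eq_intros simp: field_simps power2_eq_square)
    have "(2 * (1 + x)\<^sup>2 - 2 * x * (2 * (1 + x))) / ((1 + x)\<^sup>2)\<^sup>2 = \<kappa>' x"
    proof -
      have "2 * (1 + x)\<^sup>2 - 2 * x * (2 * (1 + x)) = (2 * (1 - x)) * (1 + x)"
        by (simp add: power2_eq_square algebra_simps)
      moreover have "((1 + x)\<^sup>2)\<^sup>2 = (1 + x) ^ 3 * (1 + x)"
        by (simp add: power2_eq_square power3_eq_cube)
      ultimately show ?thesis
        using that by (simp add: \<kappa>'_def)
    qed
    then show "(\<kappa> has_real_derivative \<kappa>' x) (at x)"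
      unfolding \<kappa>_def[abs_def] using that
      by (auto intro!: derivative_eq_intros simp: power2_eq_square)
  qed
  have deriv_cont: "continuous_on {0<..} \<phi>'" "continuous_on {0<..} \<kappa>'"
    unfolding \<phi>'_def \<kappa>'_def by (auto intro!: continuous_intros)

  have G_cont: "continuous_on (ball 0 1) G" "continuous_on (ball 0 1) (deriv G)"
    using G by (auto intro!: holomorphic_on_imp_continuous_on holomorphic_deriv)
  have X_cont: "continuous_on (ball 0 1) X"
    unfolding X_def H_def by (intro continuous_intros G_cont)
  have L_cont: "continuous_on (ball 0 1) L"
    unfolding L_def using nz by (intro continuous_intros G_cont) auto
  have \<phi>X_cont: "continuous_on (ball 0 1) (\<lambda>z. \<phi> (X z))" "continuous_on (ball 0 1) (\<lambda>z. \<kappa> (X z))"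
    unfolding \<phi>_def \<kappa>_def using pos by (auto intro!: continuous_intros X_cont)
  have N_cont: "continuous_on {0..<1} N"
    unfolding N_def
    by (rule integral_circle_continuous_on[where w = "\<lambda>z _. \<phi> (X z)", unfolded split_def],
        rule continuous_on_compose2[OF \<phi>X_cont(1)]) (auto intro: continuous_intros)
  have D_cont: "continuous_on {0..<1} D"
    unfolding D_def
    by (rule integral_circle_continuous_on[where w = "\<lambda>z _. \<phi> (X z) * Re (L z)", unfolded split_def],
        rule continuous_on_compose2[where g = "\<lambda>z. \<phi> (X z) * Re (L z)" and t = "ball 0 1"])
       (auto intro!: continuous_intros \<phi>X_cont L_cont)
  have k_cont: "continuous_on {0..<1} k"
    unfolding k_def
  proof (rule integral_circle_continuous_on[where w = "\<lambda>z \<theta>. \<kappa> (X z) * Re (cis \<theta> * (deriv G z / G z))"])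
    have "continuous_on (ball 0 1) (\<lambda>z. deriv G z / G z)"
      using nz by (intro continuous_intros G_cont) auto
    then have "continuous_on (ball 0 1 \<times> (UNIV :: real set)) (\<lambda>p. deriv G (fst p) / G (fst p))"
      by (rule continuous_on_compose2) (auto intro: continuous_intros)
    moreover have "continuous_on (ball 0 1 \<times> (UNIV :: real set)) (\<lambda>p. \<kappa> (X (fst p)))"
      by (rule continuous_on_compose2[OF \<phi>X_cont(2)]) (auto intro: continuous_intros)
    moreover have "continuous_on (ball 0 1 \<times> UNIV) (\<lambda>p::complex \<times> real. cis (snd p))"
      by (intro continuous_intros)
    ultimately show "continuous_on (ball 0 1 \<times> UNIV) (\<lambda>(z, \<theta>). \<kappa> (X z) * Re (cis \<theta> * (deriv G z / G z)))"
      unfolding split_def by (rule continuous_on_mult[OF _ continuous_on_Re[OF continuous_on_mult], rotated 2])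
  qed
  have sub: "{0..r} \<subseteq> {0..<1}"
    using r by auto
  have Q_cont: "continuous_on {0..r} Q"
    unfolding Q_def using r
    by (intro continuous_intros continuous_on_times_ln_inverse continuous_on_subset[OF N_cont sub]
        continuous_on_subset[OF D_cont sub] continuous_on_subset[OF k_cont sub])

  have Kk: "K t = t * k t" for t
  proof -
    have "Re (L (of_real t * cis \<theta>))
        = t * Re (cis \<theta> * (deriv G (of_real t * cis \<theta>) / G (of_real t * cis \<theta>)))" for \<theta>
    proof -
      have "L (of_real t * cis \<theta>)
          = of_real t * (cis \<theta> * (deriv G (of_real t * cis \<theta>) / G (of_real t * cis \<theta>)))"
        by (simp add: L_def)
      then show ?thesis
        by (simp only: times_complex.sel(1) complex_of_real_def complex.sel)
    qed
    then have "K t = integral {0..2*pi} (\<lambda>\<theta>. t * (\<kappa> (X (of_real t * cis \<theta>))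
        * Re (cis \<theta> * (deriv G (of_real t * cis \<theta>) / G (of_real t * cis \<theta>)))))"
      unfolding K_def by (simp only: mult.left_commute)
    then show ?thesis
      by (simp only: k_def Henstock_Kurzweil_Integration.integral_mult_right)
  qed
  have int: "(\<lambda>\<theta>. w (of_real t * cis \<theta>)) integrable_on {0..2*pi}"
    if "continuous_on (ball 0 1) w" "0 < t" "t < 1" for w :: "complex \<Rightarrow> real" and t
    by (rule integrable_continuous_interval, rule continuous_on_compose2[OF that(1)])
      (use that in \<open>auto intro!: continuous_intros simp: norm_mult\<close>)

  have Q_deriv: "\<exists>y. (Q has_real_derivative y) (at t) \<and> 0 \<le> y" if t: "0 < t" "t < r" for t
  proof -
    have t1: "t < 1"
      using t r by simp
    define w1 where "w1 z = 2 * X z * \<kappa>' (X z) * (cmod (L z))\<^sup>2" for z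
    define w2 where "w2 z = 2 * X z * \<phi>' (X z) * (cmod (L z))\<^sup>2" for z
    have w_cont: "continuous_on (ball 0 1) w1" "continuous_on (ball 0 1) w2"
      unfolding w1_def w2_def \<kappa>'_def \<phi>'_def using pos
      by (auto intro!: continuous_intros X_cont L_cont)
    have K': "(K has_real_derivative integral {0..2*pi} (\<lambda>\<theta>. w1 (of_real t * cis \<theta>)) / t) (at t)"
    proof (rule has_field_derivative_transform_within_open[where S = "{0<..<1}"])
      show "((\<lambda>t. integral {0..2*pi} (\<lambda>\<theta>. \<kappa> ((cmod (H (of_real t * cis \<theta>)))\<^sup>2)
          * Re (of_real t * cis \<theta> * deriv H (of_real t * cis \<theta>) / H (of_real t * cis \<theta>))))
        has_real_derivative integral {0..2*pi} (\<lambda>\<theta>. w1 (of_real t * cis \<theta>)) / t) (at t)"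
        using circle_energy_has_derivative[OF hol H_nz \<kappa>_deriv deriv_cont(2) t(1) t1] inB t(1) t1
        by (simp add: w1_def X_def H_log)
    qed (use t t1 inB in \<open>auto simp: K_def X_def H_log\<close>)
    have D': "(D has_real_derivative integral {0..2*pi} (\<lambda>\<theta>. w2 (of_real t * cis \<theta>)) / t) (at t)"
    proof (rule has_field_derivative_transform_within_open[where S = "{0<..<1}"])
      show "((\<lambda>t. integral {0..2*pi} (\<lambda>\<theta>. \<phi> ((cmod (H (of_real t * cis \<theta>)))\<^sup>2)
          * Re (of_real t * cis \<theta> * deriv H (of_real t * cis \<theta>) / H (of_real t * cis \<theta>))))
        has_real_derivative integral {0..2*pi} (\<lambda>\<theta>. w2 (of_real t * cis \<theta>)) / t) (at t)"
        using circle_energy_has_derivative[OF hol H_nz \<phi>_deriv deriv_cont(1) t(1) t1] inB t(1) t1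
        by (simp add: w2_def X_def H_log)
    qed (use t t1 inB in \<open>auto simp: D_def X_def H_log\<close>)
    \<comment> \<open>\<open>\<kappa> x = 2 x \<phi>' x\<close>, so that \<open>K\<close> is \<open>t N'\<close>; in \<open>Q'\<close> this term cancels the derivative of the logarithm.\<close>
    have N': "(N has_real_derivative K t / t) (at t)"
      using circle_mean_has_derivative[OF hol H_nz \<phi>_deriv deriv_cont(1) t(1) t1] inB t(1) t1
      by (simp add: N_def[abs_def] K_def X_def H_log \<kappa>_def \<phi>'_def)
    have ln': "((\<lambda>t. ln (r / t)) has_real_derivative - 1 / t) (at t)"
      using t r by (auto intro!: derivative_eq_intros simp: field_simps power2_eq_square)
    define I1 I2 where "I1 = integral {0..2*pi} (\<lambda>\<theta>. w1 (of_real t * cis \<theta>))"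
      and "I2 = integral {0..2*pi} (\<lambda>\<theta>. w2 (of_real t * cis \<theta>))"
    have Q_eq: "Q = (\<lambda>t. ln (r / t) * K t + N t + D t)"
      unfolding Q_def[abs_def] Kk by (simp only: mult_ac)
    have slope: "- 1 / t * K t + I1 / t * ln (r / t) + K t / t + I2 / t = (ln (r / t) * I1 + I2) / t"
      by (simp only: add_divide_distrib) argo
    have Q': "(Q has_real_derivative (ln (r / t) * I1 + I2) / t) (at t)"
      unfolding Q_eq slope[symmetric]
      by (intro DERIV_add DERIV_mult ln' K'[folded I1_def] N' D'[folded I2_def])
    have "ln (r / t) * I1 + I2
        = integral {0..2*pi} (\<lambda>\<theta>. ln (r / t) * w1 (of_real t * cis \<theta>) + w2 (of_real t * cis \<theta>))"
      unfolding I1_def I2_def Henstock_Kurzweil_Integration.integral_mult_right[symmetric]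
      by (intro Henstock_Kurzweil_Integration.integral_add[symmetric] integrable_on_mult_right
          int[OF w_cont(1) t(1) t1] int[OF w_cont(2) t(1) t1])
    moreover have "0 \<le> integral {0..2*pi} (\<lambda>\<theta>. ln (r / t) * w1 (of_real t * cis \<theta>) + w2 (of_real t * cis \<theta>))"
    proof (rule Henstock_Kurzweil_Integration.integral_nonneg)
      show "(\<lambda>\<theta>. ln (r / t) * w1 (of_real t * cis \<theta>) + w2 (of_real t * cis \<theta>)) integrable_on {0..2*pi}"
        by (intro integrable_add integrable_on_mult_right
            int[OF w_cont(1) t(1) t1] int[OF w_cont(2) t(1) t1])
      fix \<theta> :: real
      define z where "z = of_real t * cis \<theta>"
      have z: "z \<in> ball 0 1" "cmod z = t"
        using t t1 by (auto simp: z_def norm_mult)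
      have "X z * (1 - t\<^sup>2) \<le> 1"
      proof -
        have "0 \<le> 1 - t\<^sup>2" "r\<^sup>2 \<le> 1"
          using t t1 r by (auto simp: power_le_one)
        then have "X z * (1 - t\<^sup>2) \<le> 1 * ((cmod (G z))\<^sup>2 * (1 - t\<^sup>2))"
          unfolding X_eq mult.assoc by (intro mult_right_mono) auto
        then show ?thesis
          using growth[rule_format, OF z(1)] z(2) by simp
      qed
      from green_weight_nonneg[OF t r(2) X_nonneg this]
      have "0 \<le> 2 * X z / (1 + X z)\<^sup>2 * (cmod (L z))\<^sup>2 * (1 + 2 * ln (r / t) * ((1 - X z) / (1 + X z)))"
        using X_nonneg[of z] by simp
      also have "\<dots> = ln (r / t) * w1 z + w2 z"
        unfolding w1_def w2_def \<kappa>'_def \<phi>'_def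
        by (rule green_weight_eq)
      finally show "0 \<le> ln (r / t) * w1 (of_real t * cis \<theta>) + w2 (of_real t * cis \<theta>)"
        by (simp add: z_def)
    qed
    ultimately have "0 \<le> (ln (r / t) * I1 + I2) / t"
      using t(1) by (intro divide_nonneg_pos) (simp only:)
    with Q' show ?thesis by blast
  qed
  have "Q 0 \<le> Q r"
    by (rule DERIV_nonneg_imp_increasing_open[OF less_imp_le[OF r(1)] Q_deriv Q_cont])
  moreover have "Q 0 = 2 * pi * (r\<^sup>2 * (cmod (G 0))\<^sup>2 / (1 + r\<^sup>2 * (cmod (G 0))\<^sup>2))"
    by (simp add: Q_def N_def D_def L_def \<phi>_def X_eq)
  moreover have "Q r = 2 * (LINT z:ball 0 r|lborel. (finite_sph_deriv (\<lambda>z. z * G z) z)\<^sup>2)"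
  proof -
    have "Q r = N r + D r"
      using r by (simp add: Q_def)
    also have "\<dots> = integral {0..2*pi} (\<lambda>\<theta>. \<phi> (X (of_real r * cis \<theta>))
                     + \<phi> (X (of_real r * cis \<theta>)) * Re (L (of_real r * cis \<theta>)))"
      unfolding N_def D_def using r
      by (intro Henstock_Kurzweil_Integration.integral_add[symmetric]
          int[of "\<lambda>z. \<phi> (X z)"] int[of "\<lambda>z. \<phi> (X z) * Re (L z)"])
         (auto intro!: continuous_intros \<phi>X_cont L_cont)
    also have "\<dots> = 2 * (LINT z:ball 0 r|lborel. (finite_sph_deriv (\<lambda>z. z * G z) z)\<^sup>2)"
    proof -
      have "\<phi> (X z) + \<phi> (X z) * Re (L z)
          = (cmod (z * G z))\<^sup>2 / (1 + (cmod (z * G z))\<^sup>2) * (1 + Re (z * deriv G z / G z))"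
        if "cmod z = r" for z
        using that r by (simp add: \<phi>_def X_eq L_def norm_mult power_mult_distrib distrib_left)
      then show ?thesis
        unfolding spherical_area_eq_circle_integral[OF G nz r] using r by (simp add: norm_mult)
    qed
    finally show ?thesis .
  qed
  ultimately show ?thesis
    by simp
qed


section \<open>Spherically convex domains\<close>

lemma norm_stereo [simp]: "norm (stereo p) = 1"
proof (cases p)
  case (Some z)
  define y where "y = (cmod z)\<^sup>2"
  have "0 \<le> y"
    by (simp add: y_def)
  have "(norm (stereo p))\<^sup>2 = (cmod ((2 / (1 + y)) *\<^sub>R z))\<^sup>2 + ((y - 1) / (y + 1))\<^sup>2"
    by (simp add: Some stereo_def norm_Pair y_def power_divide)
  also have "\<dots> = (2 / (1 + y))\<^sup>2 * y + ((y - 1) / (y + 1))\<^sup>2"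
    by (simp add: power_mult_distrib power_divide y_def)
  also have "\<dots> = 1"
    using \<open>0 \<le> y\<close> by (simp add: divide_simps) (simp add: power2_eq_square algebra_simps)
  finally show ?thesis
    by (simp add: power2_eq_1_iff)
       (metis norm_ge_zero not_one_le_zero neg_0_le_iff_le)
qed (simp add: stereo_def norm_Pair)

text \<open>The formula of the inverse stereographic projection; at the north pole its value is the default \<open>0\<close>.\<close>

definition unstereo :: "complex \<times> real \<Rightarrow> complex" where
  "unstereo P = fst P /\<^sub>R (1 - snd P)"

lemma snd_stereo_Some: "snd (stereo (Some z)) \<noteq> 1"
  by (simp add: stereo_def divide_simps)

lemma unstereo_stereo: "unstereo (stereo (Some z)) = z"
proof -
  define y where "y = (cmod z)\<^sup>2"
  have "0 \<le> y"
    by (simp add: y_def)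
  then have "1 - (y - 1) / (y + 1) = 2 / (1 + y)" "2 / (1 + y) \<noteq> 0"
    by (auto simp: field_simps)
  then have "inverse (1 - (y - 1) / (y + 1)) * (2 / (1 + y)) = 1"
    by (simp only: left_inverse not_False_eq_True)
  then show ?thesis
    unfolding unstereo_def stereo_def option.case fst_conv snd_conv scaleR_scaleR y_def[symmetric]
    by simp
qed

lemma stereo_unstereo:
  assumes "norm P = 1" "snd P \<noteq> 1"
  shows "stereo (Some (unstereo P)) = P"
proof -
  obtain x s where P: "P = (x, s)"
    by (cases P)
  have xs: "(cmod x)\<^sup>2 = 1 - s\<^sup>2"
    using assms(1) by (simp add: P norm_Pair real_sqrt_eq_1_iff)
  have s: "s \<noteq> 1"
    using assms(2) by (simp add: P)
  have "(cmod (unstereo P))\<^sup>2 = (1 - s\<^sup>2) / (1 - s)\<^sup>2"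
    by (simp add: unstereo_def P power_mult_distrib xs power_inverse divide_inverse mult.commute)
  also have "\<dots> = (1 + s) / (1 - s)"
    using s by (simp add: divide_simps) (simp add: power2_eq_square algebra_simps)
  finally have y: "(cmod (unstereo P))\<^sup>2 = (1 + s) / (1 - s)" .
  have "1 + (1 + s) / (1 - s) = 2 / (1 - s)" "(1 + s) / (1 - s) - 1 = 2 * s / (1 - s)"
    using s by (simp_all add: field_simps)
  then have "2 / (1 + (cmod (unstereo P))\<^sup>2) = 1 - s"
    "((cmod (unstereo P))\<^sup>2 - 1) / ((cmod (unstereo P))\<^sup>2 + 1) = s"
    using s by (simp_all add: y add.commute)
  then show ?thesis
    using s by (simp add: stereo_def) (simp add: unstereo_def P)
qed

lemma inj_stereo: "inj stereo"
proof (rule injI)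
  fix p q assume eq: "stereo p = stereo q"
  show "p = q"
  proof (cases p; cases q)
    fix z w assume "p = Some z" "q = Some w"
    then show ?thesis
      using eq unstereo_stereo by metis
  qed (use eq snd_stereo_Some in \<open>auto simp: stereo_def\<close>)
qed

lemma stereo_onto:
  assumes "norm P = 1"
  obtains p where "stereo p = P"
proof (cases "snd P = 1")
  case True
  then have "P = (0, 1)"
    using assms by (cases P) (simp add: norm_Pair)
  then show ?thesis
    using that[of None] by (simp add: stereo_def)
qed (use that stereo_unstereo[OF assms] in blast)

lemma great_circle_through_unit_vectors:
  fixes P Q :: "'a::real_inner"
  assumes "norm P = 1" "norm Q = 1" "Q \<noteq> P" "Q \<noteq> - P"
  obtains v L where "norm v = 1" "P \<bullet> v = 0" "0 < L" "L < pi" "Q = cos L *\<^sub>R P + sin L *\<^sub>R v"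
proof -
  define c where "c = P \<bullet> Q"
  have PQ: "P \<bullet> P = 1" "Q \<bullet> Q = 1"
    using assms(1,2) by (simp_all add: dot_square_norm)
  have "0 < (Q - P) \<bullet> (Q - P)" "0 < (Q + P) \<bullet> (Q + P)"
    using assms(3,4) by (auto simp: add_eq_0_iff)
  then have c: "- 1 < c" "c < 1"
    using PQ by (auto simp: c_def algebra_simps inner_commute)
  define L where "L = arccos c"
  have L: "0 < L" "L < pi" "cos L = c" "sin L = sqrt (1 - c\<^sup>2)" "0 < sin L"
    using c arccos_lt_bounded[of c] unfolding L_def
    by (auto simp: sin_arccos abs_square_less_1 sin_gt_zero)
  define v where "v = (Q - c *\<^sub>R P) /\<^sub>R sin L"
  have "(Q - c *\<^sub>R P) \<bullet> (Q - c *\<^sub>R P) = 1 - c\<^sup>2"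
    using PQ by (simp add: inner_diff inner_commute c_def power2_eq_square algebra_simps)
  then have "norm (Q - c *\<^sub>R P) = sin L"
    using L(4) by (simp add: norm_eq_sqrt_inner)
  then have "norm v = 1"
    using L(5) by (simp add: v_def)
  moreover have "P \<bullet> v = 0"
    using PQ by (simp add: v_def inner_diff c_def)
  moreover have "Q = cos L *\<^sub>R P + sin L *\<^sub>R v"
    using L(3,5) by (simp add: v_def)
  ultimately show ?thesis
    using that L by blast
qed

lemma norm_great_circle:
  fixes P v :: "'a::real_inner"
  assumes "norm P = 1" "norm v = 1" "P \<bullet> v = 0"
  shows "norm (cos t *\<^sub>R P + sin t *\<^sub>R v) = 1"
proof -
  have "P \<bullet> P = 1" "v \<bullet> v = 1" "v \<bullet> P = 0"
    using assms by (simp_all add: norm_eq_1 inner_commute)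
  then have "(cos t *\<^sub>R P + sin t *\<^sub>R v) \<bullet> (cos t *\<^sub>R P + sin t *\<^sub>R v) = (cos t)\<^sup>2 + (sin t)\<^sup>2"
    using assms(3) by (simp add: inner_add power2_eq_square)
  then show ?thesis
    by (simp add: norm_eq_1)
qed

text \<open>The definition of convexity in parametric form: a point of the arc from \<open>p\<close> to \<open>q\<close> is given by its angle \<open>t\<close>.\<close>

lemma spherically_convex_arc:
  assumes conv: "spherically_convex_domain \<Omega>" and pq: "p \<in> \<Omega>" "q \<in> \<Omega>"
    and v: "norm v = 1" "stereo p \<bullet> v = 0" and L: "L < pi" and q: "stereo q = cos L *\<^sub>R stereo p + sin L *\<^sub>R v"
    and t: "0 \<le> t" "t \<le> L" and m: "stereo m = cos t *\<^sub>R stereo p + sin t *\<^sub>R v"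
  shows "m \<in> \<Omega>"
proof -
  have pp: "stereo p \<bullet> stereo p = 1"
    by (simp add: dot_square_norm)
  have "cos pi < cos L"
    using t L by (intro cos_monotone_0_pi) auto
  moreover have "stereo p \<bullet> stereo q = cos L"
    unfolding q using v pp by (simp add: inner_add_right)
  ultimately have "\<not> antipodal p q"
    using pp by (auto simp: antipodal_def)
  moreover have "m \<in> spherical_geodesic p q"
    unfolding spherical_geodesic_def great_circle_arc_def mem_Collect_eq
    using v L t q m by (intro exI[of _ "stereo p"] exI[of _ v] exI[of _ L]) auto
  ultimately show ?thesis
    using conv pq unfolding spherically_convex_domain_def by blast
qed

lemma open_finite_part:
  assumes "openin rsphere_topology \<Omega>"
  shows "open {w. Some w \<in> \<Omega>}"
proof -
  from assms consider U where "open U" "\<Omega> = Some ` U"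
    | C where "closed C" "\<Omega> = insert None (Some ` (UNIV - C))"
    unfolding rsphere_topology_def openin_Alexandroff_compactification by auto
  then show ?thesis
  proof cases
    case 1
    then have "{w. Some w \<in> \<Omega>} = U" by auto
    with 1 show ?thesis by simp
  next
    case 2
    then have "{w. Some w \<in> \<Omega>} = - C" by auto
    with 2 show ?thesis by (simp add: open_Compl)
  qed
qed

text \<open>No single geodesic joins antipodal points \<open>P\<close> and \<open>- P\<close>. But a point \<open>q\<close> of the sphere lies on a half
  circle from \<open>P\<close> to \<open>- P\<close>, and after moving \<open>P\<close> slightly towards \<open>q\<close>, which stays in the open set, the rest
  of this half circle is a geodesic in the domain and still contains \<open>q\<close>.\<close>

lemma spherically_convex_antipodal_imp_UNIV:
  assumes conv: "spherically_convex_domain \<Omega>" and w: "Some w \<in> \<Omega>"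
    and a: "a \<in> \<Omega>" "stereo a = - stereo (Some w)"
  shows "\<Omega> = UNIV"
proof -
  define P where "P = stereo (Some w)"
  have "q \<in> \<Omega>" for q
  proof (cases "stereo q = P \<or> stereo q = - P")
    case True
    then show ?thesis
      using w a inj_stereo by (metis P_def injD)
  next
    case False
    have "norm P = 1" "norm (stereo q) = 1"
      by (simp_all add: P_def)
    then obtain v \<phi> where v: "norm v = 1" "P \<bullet> v = 0" and \<phi>: "0 < \<phi>" "\<phi> < pi"
      and q: "stereo q = cos \<phi> *\<^sub>R P + sin \<phi> *\<^sub>R v"
      using False great_circle_through_unit_vectors[of P "stereo q"] by metis
    define \<gamma> where "\<gamma> e = cos e *\<^sub>R P + sin e *\<^sub>R v" for e
    have \<gamma>_lim: "(\<gamma> \<longlongrightarrow> P) (at_right 0)"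
      unfolding \<gamma>_def by (auto intro!: tendsto_eq_intros)
    have P1: "snd P \<noteq> 1"
      by (simp add: P_def snd_stereo_Some)
    have "((\<lambda>e. unstereo (\<gamma> e)) \<longlongrightarrow> unstereo P) (at_right 0)"
      unfolding unstereo_def using P1 by (intro tendsto_intros \<gamma>_lim) auto
    then have "\<forall>\<^sub>F e in at_right 0. Some (unstereo (\<gamma> e)) \<in> \<Omega>"
      using open_finite_part[of \<Omega>] conv w
      by (auto simp: spherically_convex_domain_def rsphere_domain_def P_def unstereo_stereo
          dest: topological_tendstoD[of _ _ _ "{w. Some w \<in> \<Omega>}"])
    moreover have "\<forall>\<^sub>F e in at_right 0. snd (\<gamma> e) \<noteq> 1"
      using tendsto_imp_eventually_ne[OF tendsto_snd[OF \<gamma>_lim] P1] .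
    moreover have "\<forall>\<^sub>F e in at_right 0. e < \<phi> \<and> 0 < e"
      using \<phi>(1) by (auto simp: eventually_at_right_field)
    ultimately have "\<forall>\<^sub>F e in at_right 0. Some (unstereo (\<gamma> e)) \<in> \<Omega> \<and> snd (\<gamma> e) \<noteq> 1 \<and> e < \<phi> \<and> 0 < e"
      by eventually_elim auto
    then obtain e where e: "Some (unstereo (\<gamma> e)) \<in> \<Omega>" "snd (\<gamma> e) \<noteq> 1" "e < \<phi>" "0 < e"
      using eventually_happens'[OF trivial_limit_at_right_real] by blast
    have \<gamma>e: "stereo (Some (unstereo (\<gamma> e))) = \<gamma> e"
      using norm_great_circle[OF \<open>norm P = 1\<close> v] by (intro stereo_unstereo e(2)) (simp only: \<gamma>_def)
    have "stereo a \<bullet> v = 0"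
      using a(2) v(2) by (simp add: P_def)
    moreover have "stereo (Some (unstereo (\<gamma> e))) = cos (pi - e) *\<^sub>R stereo a + sin (pi - e) *\<^sub>R v"
      unfolding a(2) P_def[symmetric] \<gamma>e by (simp add: \<gamma>_def)
    \<comment> \<open>Angles are now measured from \<open>- P\<close>, hence the complements.\<close>
    moreover have "stereo q = cos (pi - \<phi>) *\<^sub>R stereo a + sin (pi - \<phi>) *\<^sub>R v"
      unfolding a(2) P_def[symmetric] q by simp
    moreover have "pi - e < pi" "0 \<le> pi - \<phi>" "pi - \<phi> \<le> pi - e"
      using e(3,4) \<phi> by linarith+
    ultimately show "q \<in> \<Omega>"
      by (intro spherically_convex_arc[OF conv a(1) e(1) v(1), of "pi - e" "pi - \<phi>" q])
  qed
  then show ?thesis by auto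
qed

section \<open>Spherically convex images lie in a hemisphere\<close>

lemma meromorphic_map_analytic:
  assumes f: "meromorphic_map_on f S" and z: "z \<in> S" "f z \<noteq> None"
  shows "(\<lambda>w. fin_val (f w)) analytic_on {z}"
proof (rule nicely_meromorphic_on_imp_analytic_at)
  show "(\<lambda>w. fin_val (f w)) nicely_meromorphic_on S" "\<not> is_pole (\<lambda>w. fin_val (f w)) z"
    using assms by (auto simp: meromorphic_map_on_def)
qed fact

text \<open>The sphere is compact and the disc is not. In analytic terms: if \<open>f\<close> were onto, then on the complement of
  its pole it would have an inverse that is entire with values in the disc, contradicting Liouville.\<close>

lemma meromorphic_injective_not_onto:
  assumes f: "meromorphic_map_on f (ball 0 1)" and inj: "inj_on f (ball 0 1)"
  shows "f ` ball 0 1 \<noteq> UNIV"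
proof
  assume onto: "f ` ball 0 1 = UNIV"
  then have "None \<in> f ` ball 0 1"
    by simp
  then obtain z0 where z0: "z0 \<in> ball 0 1" "f z0 = None"
    by (auto simp only: image_iff)
  define S where "S = ball (0::complex) 1 - {z0}"
  define g where "g = (\<lambda>w. fin_val (f w))"
  have fin: "f z = Some (g z)" if "z \<in> S" for z
    using that z0 inj_onD[OF inj, of z z0] by (cases "f z") (auto simp: S_def g_def fin_val_def)
  have "g analytic_on {z}" if "z \<in> S" for z
    unfolding g_def using meromorphic_map_analytic[OF f, of z] fin[OF that] that by (simp add: S_def)
  then have "g analytic_on S"
    using analytic_on_analytic_at by blast
  then have "g holomorphic_on S"
    by (rule analytic_imp_holomorphic)
  moreover have "open S"
    by (auto simp: S_def)
  moreover have "inj_on g S"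
    using fin inj by (metis (no_types, lifting) DiffD1 S_def inj_on_def)
  ultimately obtain h where h: "h holomorphic_on (g ` S)" "\<And>z. z \<in> S \<Longrightarrow> h (g z) = z"
    by (metis holomorphic_has_inverse)
  have gS: "g ` S = UNIV"
  proof -
    have "w \<in> g ` S" for w
    proof -
      have "Some w \<in> f ` ball 0 1"
        unfolding onto by simp
      then obtain z where z: "z \<in> ball 0 1" "f z = Some w"
        by (auto simp only: image_iff)
      then have "z \<in> S"
        using z0 by (auto simp: S_def)
      then show ?thesis
        using fin z by (metis image_eqI option.inject)
    qed
    then show ?thesis by auto
  qed
  have "h w \<in> ball 0 1" for w
    using gS h(2) by (metis DiffD1 S_def UNIV_I imageE)
  then have "bounded (range h)"
    by (intro bounded_subset[OF bounded_ball[of 0 1]] image_subsetI)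
  then obtain c where c: "\<And>w. h w = c"
    using Liouville_theorem[of h] h(1) gS by (auto simp: constant_on_def)
  then have "S \<subseteq> {c}"
    using h(2) by force
  then have "finite (insert z0 S)"
    by (simp add: finite_subset)
  then have "finite (ball (0::complex) 1)"
    by (rule finite_subset[rotated]) (auto simp: S_def)
  then show False
    using finite_imp_bounded uncountable_ball[of 1 "0::complex"] countable_finite by force
qed

lemma spherically_convex_map_no_antipodes:
  assumes f: "spherically_convex_map f" and z: "z \<in> ball 0 1" "z' \<in> ball 0 1"
  shows "stereo (f z') \<noteq> - stereo (f z)"
proof
  assume anti: "stereo (f z') = - stereo (f z)"
  have conv: "spherically_convex_domain (f ` ball 0 1)"
    and ne: "f ` ball 0 1 \<noteq> UNIV"
    using f meromorphic_injective_not_onto by (auto simp: spherically_convex_map_def)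
  show False
  proof (cases "f z")
    case (Some w)
    then show ?thesis
      using spherically_convex_antipodal_imp_UNIV[OF conv, of w "f z'"] z anti ne by (metis imageI)
  next
    case None
    then obtain w where "f z' = Some w"
      using anti by (cases "f z'") (auto simp: stereo_def)
    then show ?thesis
      using spherically_convex_antipodal_imp_UNIV[OF conv, of w "f z"] z anti ne
      by (metis imageI add.inverse_inverse)
  qed
qed

text \<open>A positive combination of two unit vectors points to the shorter arc between them; without antipodal pairs
  this arc belongs to the domain.\<close>

lemma convex_cone_over_sphere:
  assumes conv: "spherically_convex_domain \<Omega>"
    and anti: "\<And>p q. p \<in> \<Omega> \<Longrightarrow> q \<in> \<Omega> \<Longrightarrow> stereo q \<noteq> - stereo p"
  shows "convex {s *\<^sub>R stereo p | s p. 0 < s \<and> p \<in> \<Omega>}" (is "convex ?K")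
proof -
  have comb: "a *\<^sub>R stereo p + b *\<^sub>R stereo q \<in> ?K"
    if ab: "0 < a" "0 < b" and pq: "p \<in> \<Omega>" "q \<in> \<Omega>" for a b p q
  proof (cases "stereo q = stereo p")
    case True
    then have "a *\<^sub>R stereo p + b *\<^sub>R stereo q = (a + b) *\<^sub>R stereo p"
      by (simp add: scaleR_add_left)
    moreover have "0 < a + b"
      using ab by simp
    ultimately show ?thesis
      using pq(1) by blast
  next
    case False
    define P where "P = stereo p"
    obtain v L where v: "norm v = 1" "P \<bullet> v = 0" and L: "0 < L" "L < pi"
      and q: "stereo q = cos L *\<^sub>R P + sin L *\<^sub>R v"
      using great_circle_through_unit_vectors[of P "stereo q"] False anti[OF pq]
      by (metis P_def norm_stereo)
    define x y where "x = a + b * cos L" and "y = b * sin L"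
    have "0 < y"
      using ab L by (simp add: y_def sin_gt_zero)
    define N where "N = sqrt (x\<^sup>2 + y\<^sup>2)"
    have "0 < x\<^sup>2 + y\<^sup>2"
      using \<open>0 < y\<close> by (intro add_nonneg_pos) auto
    then have "0 < N" and N2: "N\<^sup>2 = x\<^sup>2 + y\<^sup>2"
      unfolding N_def by (auto simp only: real_sqrt_gt_0_iff real_sqrt_pow2 less_imp_le)
    have "(x / N)\<^sup>2 + (y / N)\<^sup>2 = (x\<^sup>2 + y\<^sup>2) / N\<^sup>2"
      by (simp only: power_divide add_divide_distrib)
    also have "\<dots> = 1"
      using \<open>0 < N\<close> by (simp add: N2[symmetric])
    finally have "(x / N)\<^sup>2 + (y / N)\<^sup>2 = 1" .
    then obtain t where t: "0 \<le> t" "t < 2 * pi" "x / N = cos t" "y / N = sin t"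
      using sincos_total_2pi by metis
    have xy: "x = N * cos t" "y = N * sin t"
      using t(3,4) \<open>0 < N\<close> by (auto simp: field_simps)
    have "0 < sin t"
      using \<open>0 < y\<close> \<open>0 < N\<close> t(4) by (metis divide_pos_pos)
    then have "t < pi"
      using t(1,2) sin_le_zero[of t] by (meson leD linorder_not_le)
    \<comment> \<open>The direction of the combination has an angle \<open>t \<le> L\<close>, because \<open>N sin (L - t) = a sin L\<close> is positive.\<close>
    have "N * sin (L - t) = sin L * x - cos L * y"
      by (simp add: sin_diff xy algebra_simps)
    also have "\<dots> = a * sin L"
      by (simp add: x_def y_def algebra_simps)
    finally have "0 < N * sin (L - t)"
      using ab L by (simp add: sin_gt_zero)
    then have "0 < sin (L - t)"
      using \<open>0 < N\<close> by (simp add: zero_less_mult_iff)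
    then have "t \<le> L"
      using sin_ge_zero[of "t - L"] \<open>t < pi\<close> L by (smt (verit) sin_minus)
    have "norm (cos t *\<^sub>R P + sin t *\<^sub>R v) = 1"
      using v by (intro norm_great_circle) (simp_all add: P_def)
    then obtain m where m: "stereo m = cos t *\<^sub>R P + sin t *\<^sub>R v"
      by (rule stereo_onto)
    have "m \<in> \<Omega>"
      using spherically_convex_arc[OF conv pq v(1) _ L(2)] v(2) q m t(1) \<open>t \<le> L\<close> by (simp add: P_def)
    moreover have "a *\<^sub>R stereo p + b *\<^sub>R stereo q = x *\<^sub>R P + y *\<^sub>R v"
      by (simp add: q P_def[symmetric] x_def y_def algebra_simps)
    then have "a *\<^sub>R stereo p + b *\<^sub>R stereo q = N *\<^sub>R stereo m"
      by (simp add: m xy algebra_simps)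
    ultimately show ?thesis
      using \<open>0 < N\<close> by blast
  qed
  show ?thesis
  proof (rule convexI)
    fix X Y :: "complex \<times> real" and u v :: real
    assume X: "X \<in> ?K" and Y: "Y \<in> ?K" and uv: "0 \<le> u" "0 \<le> v" "u + v = 1"
    show "u *\<^sub>R X + v *\<^sub>R Y \<in> ?K"
    proof (cases "u = 0 \<or> v = 0")
      case True
      then consider "u *\<^sub>R X + v *\<^sub>R Y = X" | "u *\<^sub>R X + v *\<^sub>R Y = Y"
        using uv by fastforce
      then show ?thesis
        using X Y by cases (simp_all only:)
    next
      case False
      from X Y obtain s p s' p' where sp: "X = s *\<^sub>R stereo p" "0 < s" "p \<in> \<Omega>"
        "Y = s' *\<^sub>R stereo p'" "0 < s'" "p' \<in> \<Omega>"
        by blast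
      then show ?thesis
        using comb[of "u * s" "v * s'" p p'] False uv by simp
    qed
  qed
qed

text \<open>The cone over the image is convex and omits the origin, so a plane through the origin bounds it; this
  plane cuts the sphere in a great circle.\<close>

lemma spherically_convex_map_in_hemisphere:
  assumes f: "spherically_convex_map f"
  obtains n where "n \<noteq> 0" "\<And>z. z \<in> ball 0 1 \<Longrightarrow> 0 \<le> n \<bullet> stereo (f z)"
proof -
  let ?K = "{s *\<^sub>R stereo p | s p. 0 < s \<and> p \<in> f ` ball 0 1}"
  have convex: "convex ?K"
    using f spherically_convex_map_no_antipodes[OF f]
    by (intro convex_cone_over_sphere) (auto simp: spherically_convex_map_def)
  have nonzero: "0 \<notin> ?K"
  proof
    assume "0 \<in> ?K"
    then obtain s p where sp: "0 = s *\<^sub>R stereo p" "0 < s"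
      unfolding mem_Collect_eq by (elim exE conjE)
    from arg_cong[OF sp(1), of norm] sp(2) show False
      by simp
  qed
  from separating_hyperplane_set_0[OF convex nonzero]
  obtain n where n: "n \<noteq> 0" "\<forall>X\<in>?K. 0 \<le> n \<bullet> X"
    by (elim exE conjE)
  have "0 \<le> n \<bullet> stereo (f z)" if "z \<in> ball 0 1" for z
  proof -
    have "1 *\<^sub>R stereo (f z) \<in> ?K"
      unfolding mem_Collect_eq using that
      by (intro exI[of _ "1::real"] exI[of _ "f z"] conjI imageI) simp_all
    then have "0 \<le> n \<bullet> (1 *\<^sub>R stereo (f z))"
      by (rule bspec[OF n(2)])
    then show ?thesis
      by simp
  qed
  then show ?thesis
    using that n(1) by blast
qed


section \<open>Rotations of the sphere\<close>

text \<open>Up to a positive factor the matrix of the Moebius map is unitary, which makes the spherical derivative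
  invariant where \<open>f\<close> is finite. At the only possible pole, \<open>F\<close> is continuous, so the singularity is removable
  and the invariance extends by continuity.\<close>

lemma rotated_meromorphic_map:
  assumes f: "meromorphic_map_on f (ball 0 1)" and inj: "inj_on f (ball 0 1)"
    and AB: "A \<noteq> 0 \<or> B \<noteq> 0"
    and F: "\<forall>z\<in>ball 0 1. moebius A B (- cnj B) (cnj A) (f z) = Some (F z)"
  shows "F holomorphic_on ball 0 1"
    and "\<And>z. z \<in> ball 0 1 \<Longrightarrow> sph_deriv f z = finite_sph_deriv F z"
proof -
  define g where "g = (\<lambda>w. fin_val (f w))"
  define P where "P = {z \<in> ball 0 1. f z = None}"
  define U where "U = ball 0 1 - P"
  define e where "e z = cnj A - cnj B * g z" for z
  define M where "M = (cmod A)\<^sup>2 + (cmod B)\<^sup>2"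
  have M_pos: "0 < M"
    using AB by (auto simp: M_def intro: add_pos_nonneg add_nonneg_pos)
  have "P \<subseteq> {z}" if "z \<in> P" for z
    using that inj_onD[OF inj, of _ z] by (auto simp: P_def)
  then have "finite P"
    by (metis finite.emptyI finite_insert finite_subset subset_emptyI)
  then have U: "open U"
    by (auto simp: U_def intro: open_Diff finite_imp_closed)
  have fin: "f z = Some (g z)" if "z \<in> U" for z
    using that by (cases "f z") (auto simp: U_def P_def g_def fin_val_def)
  have e_nz: "e z \<noteq> 0" and F_eq: "F z = (A * g z + B) / e z" if "z \<in> U" for z
    using F[rule_format, of z] that by (auto simp: fin[OF that] moebius_def e_def U_def split: if_splits)
  have "g analytic_on {z}" if "z \<in> U" for z
    unfolding g_def using meromorphic_map_analytic[OF f, of z] fin[OF that] that by (simp add: U_def)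
  then have g_hol: "g holomorphic_on U"
    using analytic_on_analytic_at analytic_imp_holomorphic by blast
  have dF: "(F has_field_derivative of_real M * deriv g z / (e z)\<^sup>2) (at z)" if z: "z \<in> U" for z
  proof -
    have dg: "(g has_field_derivative deriv g z) (at z)"
      using holomorphic_derivI[OF g_hol U z] .
    have dN: "((\<lambda>z. A * g z + B) has_field_derivative A * deriv g z) (at z)"
      using DERIV_add[OF DERIV_cmult[OF dg, of A] DERIV_const[of B]] by simp
    have de: "(e has_field_derivative - (cnj B * deriv g z)) (at z)"
      unfolding e_def[abs_def] using DERIV_diff[OF DERIV_const[of "cnj A"] DERIV_cmult[OF dg, of "cnj B"]] by simp
    have "((\<lambda>z. (A * g z + B) / e z) has_field_derivative
        (A * deriv g z * e z - (A * g z + B) * (- (cnj B * deriv g z))) / (e z * e z)) (at z)"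
      by (rule DERIV_divide[OF dN de e_nz[OF z]])
    also have "A * deriv g z * e z - (A * g z + B) * (- (cnj B * deriv g z)) = of_real M * deriv g z"
      unfolding e_def M_def of_real_add complex_norm_square by (simp add: algebra_simps)
    finally have "((\<lambda>z. (A * g z + B) / e z) has_field_derivative of_real M * deriv g z / (e z)\<^sup>2) (at z)"
      by (simp add: power2_eq_square)
    then show ?thesis
      by (rule has_field_derivative_transform_within_open[OF _ U z]) (simp add: F_eq)
  qed
  \<comment> \<open>Both \<open>|F'|\<close> and \<open>1 + |F|\<^sup>2\<close> pick up the factor \<open>M / |e|\<^sup>2\<close>.\<close>
  have sph_eq: "finite_sph_deriv F z = finite_sph_deriv g z" if z: "z \<in> U" for z
  proof -
    define a where "a = (cmod (e z))\<^sup>2"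
    have a: "0 < a"
      using e_nz[OF z] by (simp add: a_def)
    have "a * (1 + (cmod (F z))\<^sup>2) = a + (cmod (A * g z + B))\<^sup>2"
      using a by (simp add: F_eq[OF z] norm_divide power_divide a_def field_simps)
    also have "complex_of_real (a + (cmod (A * g z + B))\<^sup>2) = of_real (M * (1 + (cmod (g z))\<^sup>2))"
      unfolding a_def e_def M_def of_real_add of_real_mult complex_norm_square
      by (simp add: algebra_simps complex_norm_square[unfolded of_real_power])
    then have "a + (cmod (A * g z + B))\<^sup>2 = M * (1 + (cmod (g z))\<^sup>2)"
      by (simp only: of_real_eq_iff)
    finally have 1: "1 + (cmod (F z))\<^sup>2 = M * (1 + (cmod (g z))\<^sup>2) / a"
      using a by (simp add: field_simps)
    have 2: "cmod (deriv F z) = M * cmod (deriv g z) / a"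
      using M_pos by (simp add: DERIV_imp_deriv[OF dF[OF z]] norm_divide norm_mult norm_power a_def)
    show ?thesis
      unfolding finite_sph_deriv_def 1 2 using M_pos a by simp
  qed
  have near_pole: "\<forall>\<^sub>F w in at z. w \<in> U" if "z \<in> ball 0 1" for z
  proof -
    have "\<forall>\<^sub>F w in at z. w \<in> ball 0 1"
      using that by (intro eventually_at_in_open') auto
    moreover have "\<forall>\<^sub>F w in at z. w \<in> - P \<or> w = z"
      using \<open>finite P\<close> eventually_at_topological[of "\<lambda>w. w \<notin> P" z UNIV]
      by (metis (mono_tags, lifting) ComplI eventually_at_filter eventually_mono
          islimpt_finite islimpt_iff_eventually)
    moreover have "\<forall>\<^sub>F w in at z. w \<noteq> z"
      by (simp add: eventually_at_filter)
    ultimately show ?thesis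
      by eventually_elim (auto simp: U_def)
  qed
  have F_cont: "isCont F z" if z: "z \<in> ball 0 1" for z
  proof (cases "z \<in> U")
    case True
    then show ?thesis
      using dF DERIV_isCont by blast
  next
    case False
    then have fz: "f z = None"
      using z by (auto simp: U_def P_def)
    then have B: "B \<noteq> 0" and Fz: "F z = A / (- cnj B)"
      using F[rule_format, OF z] by (auto simp: moebius_def split: if_splits)
    have "is_pole g z"
      using f z fz by (auto simp: meromorphic_map_on_def g_def)
    then have lim: "filterlim g at_infinity (at z)"
      by (simp add: is_pole_def)
    then have inv: "((\<lambda>w. inverse (g w)) \<longlongrightarrow> 0) (at z)"
      by (rule filterlim_compose[OF tendsto_inverse_0])
    have "((\<lambda>w. (A + B * inverse (g w)) / (cnj A * inverse (g w) - cnj B)) \<longlongrightarrow> (A + B * 0) / (cnj A * 0 - cnj B)) (at z)"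
      using B by (intro tendsto_intros inv) auto
    moreover have "\<forall>\<^sub>F w in at z. (A + B * inverse (g w)) / (cnj A * inverse (g w) - cnj B) = F w"
      using near_pole[OF z] non_zero_neighbour_pole[OF \<open>is_pole g z\<close>]
    proof eventually_elim
      case (elim w)
      then have "(A + B * inverse (g w)) / (cnj A * inverse (g w) - cnj B)
          = ((A + B * inverse (g w)) * g w) / ((cnj A * inverse (g w) - cnj B) * g w)"
        by simp
      also have "\<dots> = F w"
        using elim by (simp add: F_eq e_def algebra_simps)
      finally show ?case .
    qed
    ultimately show ?thesis
      unfolding isCont_def Fz by (auto dest: Lim_transform_eventually)
  qed
  have F_hol_U: "F holomorphic_on ball 0 1 - P"
    unfolding U_def[symmetric] holomorphic_on_open[OF U] using dF by blast
  have F_cont_on: "continuous_on (ball 0 1) F"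
    using F_cont by (intro continuous_at_imp_continuous_on ballI)
  show F_hol: "F holomorphic_on ball 0 1"
    by (rule no_isolated_singularity[OF F_cont_on F_hol_U open_ball \<open>finite P\<close>])
  show "sph_deriv f z = finite_sph_deriv F z" if z: "z \<in> ball 0 1" for z
  proof (cases "f z")
    case (Some w)
    then show ?thesis
      using sph_eq[of z] z by (simp add: sph_deriv_def g_def U_def P_def)
  next
    case None
    have "isCont (finite_sph_deriv F) z"
    proof -
      have "1 + (cmod (F z))\<^sup>2 \<noteq> 0"
        by (metis add_pos_nonneg less_numeral_extra(1) less_numeral_extra(3) zero_le_power2)
      moreover have "isCont (deriv F) z"
        using holomorphic_deriv[OF F_hol] z
        by (metis continuous_on_eq_continuous_at holomorphic_on_imp_continuous_on open_ball)
      ultimately show ?thesis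
        unfolding finite_sph_deriv_def by (intro continuous_intros F_cont z)
    qed
    then have "(finite_sph_deriv F \<longlongrightarrow> finite_sph_deriv F z) (at z)"
      by (simp add: isCont_def)
    then have "(finite_sph_deriv g \<longlongrightarrow> finite_sph_deriv F z) (at z)"
      by (rule Lim_transform_eventually) (use near_pole[OF z] sph_eq in \<open>auto elim: eventually_mono\<close>)
    then show ?thesis
      using None by (simp add: sph_deriv_def g_def tendsto_Lim)
  qed
qed

text \<open>Up to the factor \<open>1 + |w|\<^sup>2\<close>, a linear form on the unit sphere is a Hermitian form of trace zero in the
  stereographic coordinate.\<close>

lemma inner_stereo_Some:
  "(1 + (cmod w)\<^sup>2) * (n \<bullet> stereo (Some w)) = 2 * Re (cnj (fst n) * w) + snd n * ((cmod w)\<^sup>2 - 1)"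
proof -
  have "1 + (cmod w)\<^sup>2 \<noteq> 0"
    by (metis add_pos_nonneg less_numeral_extra(1) less_numeral_extra(3) zero_le_power2)
  moreover have "n \<bullet> stereo (Some w)
      = 2 / (1 + (cmod w)\<^sup>2) * Re (cnj (fst n) * w) + snd n * ((cmod w)\<^sup>2 - 1) / (1 + (cmod w)\<^sup>2)"
    by (cases n) (simp add: stereo_def inner_complex_def add.commute add_divide_distrib mult.left_commute)
  ultimately show ?thesis
    by (simp add: distrib_left)
qed

text \<open>The behaviour of the form in \<open>inner_stereo_Some\<close> under a rotation, in polynomial form: primed letters
  stand for complex conjugates, and \<open>\<alpha>\<close>, \<open>\<beta>\<close> are the coefficients of the transformed form. The second identity
  says that the rotation multiplies the length of the coefficient vector \<open>(m, n)\<close> by a constant; it excludes a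
  vanishing transformed form.\<close>

lemma hermitian_form_rotation_identity:
  fixes A A' B B' w w' m m' n :: "'a::comm_ring_1"
  defines "\<alpha> \<equiv> - (m' * A' * B + m * A * B' + n * (A * A' - B * B'))"
    and "\<beta> \<equiv> m' * A'\<^sup>2 - m * B'\<^sup>2 - 2 * n * A' * B'" and "\<beta>' \<equiv> m * A\<^sup>2 - m' * B\<^sup>2 - 2 * n * A * B"
  shows "\<alpha> * ((A' - B' * w) * (A - B * w') - (A * w + B) * (A' * w' + B'))
           + \<beta> * (A * w + B) * (A - B * w') + \<beta>' * (A' * w' + B') * (A' - B' * w)
       = (A * A' + B * B')\<^sup>2 * (m' * w + m * w' + n * (w * w' - 1))"
    and "\<alpha>\<^sup>2 + \<beta> * \<beta>' = (A * A' + B * B')\<^sup>2 * (m * m' + n\<^sup>2)"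
  unfolding \<alpha>_def \<beta>_def \<beta>'_def by (simp_all add: power2_eq_square algebra_simps)

text \<open>A rotation maps a hemisphere to a hemisphere; the closed hemisphere with normal \<open>n\<close> becomes the set given by
  \<open>\<alpha>\<close> and \<open>\<beta>\<close>.\<close>

lemma hemisphere_rotation:
  fixes A B :: complex and n :: "complex \<times> real"
  assumes AB: "A \<noteq> 0 \<or> B \<noteq> 0" and n: "n \<noteq> 0"
  obtains \<alpha> :: real and \<beta> :: complex where "\<alpha> \<noteq> 0 \<or> \<beta> \<noteq> 0"
    "\<And>p u. moebius A B (- cnj B) (cnj A) p = Some u \<Longrightarrow> 0 \<le> n \<bullet> stereo p
       \<Longrightarrow> 0 \<le> \<alpha> * (1 - (cmod u)\<^sup>2) + 2 * Re (\<beta> * u)"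
proof -
  obtain m h where n_eq: "n = (m, h)"
    by (cases n)
  define M where "M = (cmod A)\<^sup>2 + (cmod B)\<^sup>2"
  have M_pos: "0 < M"
    using AB by (auto simp: M_def intro: add_pos_nonneg add_nonneg_pos)
  define \<alpha> where "\<alpha> = - (2 * Re (cnj m * cnj A * B) + h * ((cmod A)\<^sup>2 - (cmod B)\<^sup>2))"
  define \<beta> where "\<beta> = cnj m * (cnj A)\<^sup>2 - m * (cnj B)\<^sup>2 - 2 * of_real h * cnj A * cnj B"
  have sq: "of_real ((cmod x)\<^sup>2) = x * cnj x" for x
    by (simp add: complex_norm_square[symmetric])
  have re: "complex_of_real (2 * Re x) = x + cnj x" for x
    by (simp add: complex_add_cnj)
  have \<alpha>_eq: "of_real \<alpha> = - (cnj m * cnj A * B + m * A * cnj B + of_real h * (A * cnj A - B * cnj B))"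
    unfolding \<alpha>_def of_real_minus of_real_add of_real_mult[of h] of_real_diff sq re by simp
  have \<beta>'_eq: "cnj \<beta> = m * A\<^sup>2 - cnj m * B\<^sup>2 - 2 * of_real h * A * B"
    by (simp add: \<beta>_def)
  have M_eq: "of_real M = A * cnj A + B * cnj B"
    unfolding M_def of_real_add sq ..
  note id = hermitian_form_rotation_identity[of "cnj m" "cnj A" B m A "cnj B" "of_real h",
      folded \<alpha>_eq \<beta>_def \<beta>'_eq M_eq]
  have "complex_of_real (\<alpha>\<^sup>2 + (cmod \<beta>)\<^sup>2) = of_real (M\<^sup>2 * ((cmod m)\<^sup>2 + h\<^sup>2))"
    unfolding of_real_add of_real_mult sq
    unfolding of_real_power using id(2) .
  then have "\<alpha>\<^sup>2 + (cmod \<beta>)\<^sup>2 = M\<^sup>2 * ((cmod m)\<^sup>2 + h\<^sup>2)"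
    by (simp only: of_real_eq_iff)
  moreover have "0 < (cmod m)\<^sup>2 + h\<^sup>2"
    using n by (auto simp: n_eq zero_prod_def intro: add_pos_nonneg add_nonneg_pos)
  ultimately have nz: "\<alpha> \<noteq> 0 \<or> \<beta> \<noteq> 0"
    using M_pos by (auto simp: zero_less_mult_iff)
  have "0 \<le> \<alpha> * (1 - (cmod u)\<^sup>2) + 2 * Re (\<beta> * u)"
    if u: "moebius A B (- cnj B) (cnj A) p = Some u" and p: "0 \<le> n \<bullet> stereo p" for p u
  proof (cases p)
    case None
    then have B: "B \<noteq> 0" and u_eq: "u * cnj B = - A"
      using u by (auto simp: moebius_def split: if_splits)
    have h: "0 \<le> h"
      using p by (simp add: None n_eq stereo_def)
    have "of_real ((cmod B)\<^sup>2 * (\<alpha> * (1 - (cmod u)\<^sup>2) + 2 * Re (\<beta> * u)))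
        = of_real \<alpha> * (B * cnj B - (u * cnj B) * cnj (u * cnj B))
          + \<beta> * (u * cnj B) * B + cnj \<beta> * cnj (u * cnj B) * cnj B"
      unfolding of_real_mult[of "(cmod B)\<^sup>2"] of_real_mult[of \<alpha>] of_real_add of_real_diff re sq
      by (simp add: algebra_simps)
    also have "\<dots> = of_real (M\<^sup>2 * h)"
      unfolding u_eq of_real_mult of_real_power \<alpha>_eq \<beta>'_eq M_eq unfolding \<beta>_def
      by (simp add: power2_eq_square algebra_simps)
    finally have "(cmod B)\<^sup>2 * (\<alpha> * (1 - (cmod u)\<^sup>2) + 2 * Re (\<beta> * u)) = M\<^sup>2 * h"
      by (simp only: of_real_eq_iff)
    then show ?thesis
      using h B by (metis mult_nonneg_nonneg zero_le_mult_iff zero_le_power2 zero_less_norm_iff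
          zero_less_power not_less)
  next
    case (Some w)
    define e where "e = cnj A - cnj B * w"
    have e: "e \<noteq> 0" and u_eq: "u * e = A * w + B"
      using u by (auto simp: Some moebius_def e_def split: if_splits)
    have "0 \<le> (1 + (cmod w)\<^sup>2) * (n \<bullet> stereo p)"
      using p by (intro mult_nonneg_nonneg) auto
    then have E: "0 \<le> 2 * Re (cnj m * w) + h * ((cmod w)\<^sup>2 - 1)"
      unfolding Some inner_stereo_Some by (simp add: n_eq)
    have "of_real ((cmod e)\<^sup>2 * (\<alpha> * (1 - (cmod u)\<^sup>2) + 2 * Re (\<beta> * u)))
        = of_real \<alpha> * (e * cnj e - (u * e) * cnj (u * e))
          + \<beta> * (u * e) * cnj e + cnj \<beta> * cnj (u * e) * e"
      unfolding of_real_mult[of "(cmod e)\<^sup>2"] of_real_mult[of \<alpha>] of_real_add of_real_diff re sq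
      by (simp add: algebra_simps)
    also have "\<dots> = (of_real M)\<^sup>2 * (cnj m * w + m * cnj w + of_real h * (w * cnj w - 1))"
      unfolding u_eq using id(1)[of w "cnj w"] by (simp add: e_def)
    also have "\<dots> = of_real (M\<^sup>2 * (2 * Re (cnj m * w) + h * ((cmod w)\<^sup>2 - 1)))"
      unfolding of_real_mult[of "M\<^sup>2"] of_real_mult[of h] of_real_add of_real_diff re sq by simp
    finally have "(cmod e)\<^sup>2 * (\<alpha> * (1 - (cmod u)\<^sup>2) + 2 * Re (\<beta> * u))
        = M\<^sup>2 * (2 * Re (cnj m * w) + h * ((cmod w)\<^sup>2 - 1))"
      by (simp only: of_real_eq_iff)
    then show ?thesis
      using E e by (metis mult_nonneg_nonneg zero_le_mult_iff zero_le_power2 zero_less_norm_iff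
          zero_less_power not_less)
  qed
  with nz show ?thesis
    using that by blast
qed


section \<open>Growth of functions with values in a hemisphere\<close>

text \<open>The image is open and contains \<open>0\<close>, so \<open>0\<close> is interior to the hemisphere and \<open>\<alpha> > 0\<close>. With \<open>c\<close> and \<open>R\<close>
  as below, the hemisphere is the disc \<open>R |u| \<le> |1 + cnj c u|\<close>, and \<open>u \<mapsto> R u / (1 + cnj c u)\<close> maps it to the
  unit disc and fixes \<open>0\<close>. The Schwarz lemma for the composition \<open>\<omega>\<close> gives
  \<open>(R - |z| |c|) |F z| \<le> |z|\<close>, and the worst \<open>c\<close> leaves the stated bound, by Cauchy-Schwarz. Moreover
  \<open>\<omega>'(0) = R F'(0)\<close> with \<open>R \<ge> 1\<close>, so \<open>|F'(0)| = 1\<close> forces \<open>c = 0\<close> and equality in the Schwarz lemma.\<close>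

lemma growth_in_hemisphere:
  fixes F :: "complex \<Rightarrow> complex" and \<alpha> :: real and \<beta> :: complex
  assumes F: "F holomorphic_on ball 0 1" and inj: "inj_on F (ball 0 1)" and F0: "F 0 = 0"
    and nz: "\<alpha> \<noteq> 0 \<or> \<beta> \<noteq> 0"
    and half: "\<forall>z\<in>ball 0 1. 0 \<le> \<alpha> * (1 - (cmod (F z))\<^sup>2) + 2 * Re (\<beta> * F z)"
  shows "\<And>z. z \<in> ball 0 1 \<Longrightarrow> (cmod (F z))\<^sup>2 * (1 - (cmod z)\<^sup>2) \<le> (cmod z)\<^sup>2"
    and "cmod (deriv F 0) = 1 \<Longrightarrow> \<exists>\<eta>. cmod \<eta> = 1 \<and> (\<forall>z\<in>ball 0 1. F z = \<eta> * z)"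
proof -
  have "0 \<le> \<alpha>"
    using half[rule_format, of 0] F0 by simp
  moreover have "\<alpha> \<noteq> 0"
  proof
    assume "\<alpha> = 0"
    then have \<beta>: "\<beta> \<noteq> 0" and Re: "\<And>z. z \<in> ball 0 1 \<Longrightarrow> 0 \<le> Re (\<beta> * F z)"
      using nz half by auto
    have "open (F ` ball 0 1)"
      by (rule open_mapping_thm3[OF F open_ball inj])
    moreover have "0 \<in> F ` ball 0 1"
      using F0 by (metis centre_in_ball imageI zero_less_one)
    ultimately obtain e where e: "0 < e" "ball 0 e \<subseteq> F ` ball 0 1"
      by (meson open_contains_ball)
    define s where "s = e / 2 / cmod \<beta>"
    have "0 < s" "s * cmod \<beta> < e"
      using e(1) \<beta> by (simp_all add: s_def)
    then have "- of_real s * cnj \<beta> \<in> ball 0 e"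
      by (simp add: norm_mult)
    then have "- of_real s * cnj \<beta> \<in> F ` ball 0 1"
      by (rule subsetD[OF e(2)])
    then obtain z where z: "z \<in> ball 0 1" "F z = - of_real s * cnj \<beta>"
      by (elim imageE) simp
    have "\<beta> * F z = of_real (- s * (cmod \<beta>)\<^sup>2)"
      unfolding z(2) of_real_mult complex_norm_square by simp
    then have "Re (\<beta> * F z) = - s * (cmod \<beta>)\<^sup>2"
      by (simp only: Re_complex_of_real)
    moreover have "0 < s * (cmod \<beta>)\<^sup>2"
      using \<open>0 < s\<close> \<beta> by simp
    ultimately show False
      using Re[OF z(1)] by simp
  qed
  ultimately have \<alpha>: "0 < \<alpha>"
    by simp
  define c where "c = cnj \<beta> / of_real \<alpha>"
  define R where "R = sqrt (1 + (cmod c)\<^sup>2)"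
  define d where "d z = 1 + cnj c * F z" for z
  have R: "1 \<le> R" "R\<^sup>2 = 1 + (cmod c)\<^sup>2"
    by (simp_all add: R_def)
  have Fd: "R * cmod (F z) \<le> cmod (d z)" if z: "z \<in> ball 0 1" for z
  proof -
    have "\<beta> = of_real \<alpha> * cnj c"
      using \<alpha> by (simp add: c_def)
    then have "0 \<le> \<alpha> * (1 - (cmod (F z))\<^sup>2 + 2 * Re (cnj c * F z))"
      using half[rule_format, OF z] by (simp add: algebra_simps)
    then have "(cmod (F z))\<^sup>2 \<le> 1 + 2 * Re (cnj c * F z)"
      using \<alpha> by (simp add: zero_le_mult_iff)
    moreover have "(cmod (d z))\<^sup>2 = 1 + 2 * Re (cnj c * F z) + (cmod (cnj c * F z))\<^sup>2"
      unfolding d_def cmod_power2 by (simp add: power2_eq_square algebra_simps)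
    ultimately have "(R * cmod (F z))\<^sup>2 \<le> (cmod (d z))\<^sup>2"
      by (simp add: power_mult_distrib R(2) norm_mult algebra_simps)
    then show ?thesis
      by (rule power2_le_imp_le) simp
  qed
  have d_nz: "d z \<noteq> 0" if z: "z \<in> ball 0 1" for z
  proof
    assume "d z = 0"
    with Fd[OF z] R(1) have "F z = 0"
      by (simp add: mult_le_0_iff)
    with \<open>d z = 0\<close> show False
      by (simp add: d_def)
  qed
  define \<omega> where "\<omega> z = of_real R * F z / d z" for z
  have \<omega>: "\<omega> holomorphic_on ball 0 1"
    unfolding \<omega>_def d_def using d_nz[unfolded d_def] by (intro holomorphic_intros F) auto
  have \<omega>0: "\<omega> 0 = 0"
    by (simp add: \<omega>_def F0)
  have \<omega>_le: "cmod (\<omega> z) \<le> 1" if "z \<in> ball 0 1" for z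
    using Fd[OF that] R(1) d_nz[OF that] by (simp add: \<omega>_def norm_divide norm_mult)
  have schwarz: "cmod (\<omega> z) \<le> cmod z" if z: "z \<in> ball 0 1" for z
  proof (rule field_le_mult_one_interval)
    \<comment> \<open>The Schwarz lemma asks for \<open>|\<omega>| < 1\<close>, but only \<open>|\<omega>| \<le> 1\<close> is known; hence the factor \<open>s\<close>.\<close>
    fix s :: real assume s: "0 < s" "s < 1"
    have "cmod (of_real s * \<omega> w) < 1" if "cmod w < 1" for w
    proof -
      have "s * cmod (\<omega> w) \<le> s * 1"
        using \<omega>_le[of w] that s by (intro mult_left_mono) auto
      also have "\<dots> < 1"
        using s by simp
      finally show ?thesis
        using s by (simp add: norm_mult)
    qed
    then have "cmod (of_real s * \<omega> z) \<le> cmod z"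
      using \<omega> \<omega>0 z by (intro Schwarz_Lemma(1)) (auto intro!: holomorphic_intros)
    then show "s * cmod (\<omega> z) \<le> cmod z"
      using s by (simp add: norm_mult)
  qed
  have \<omega>_less: "cmod (\<omega> z) < 1" if "cmod z < 1" for z
    using schwarz[of z] that by simp
  show "(cmod (F z))\<^sup>2 * (1 - (cmod z)\<^sup>2) \<le> (cmod z)\<^sup>2" if z: "z \<in> ball 0 1" for z
  proof -
    define t q where "t = cmod z" and "q = sqrt (1 - t\<^sup>2)"
    have "t < 1" "0 \<le> t"
      using z by (auto simp: t_def)
    then have q: "0 \<le> q" "q\<^sup>2 = 1 - t\<^sup>2"
      by (auto simp: q_def abs_square_le_1)
    \<comment> \<open>Lagrange's identity for the vectors \<open>(t, q)\<close> and \<open>(|c|, 1)\<close>.\<close>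
    have "(t * cmod c + q)\<^sup>2 + (t - q * cmod c)\<^sup>2 = (t\<^sup>2 + q\<^sup>2) * (1 + (cmod c)\<^sup>2)"
      by (simp add: power2_eq_square algebra_simps)
    also have "\<dots> = R\<^sup>2"
      by (simp add: q(2) R(2))
    finally have "(t * cmod c + q)\<^sup>2 \<le> R\<^sup>2"
      using zero_le_power2[of "t - q * cmod c"] by linarith
    then have tq: "t * cmod c + q \<le> R"
      by (rule power2_le_imp_le) (use R(1) in simp)
    have "R * cmod (F z) \<le> t * cmod (d z)"
      using schwarz[OF z] d_nz[OF z] R(1)
      by (simp add: \<omega>_def norm_divide norm_mult t_def field_simps)
    also have "\<dots> \<le> t * (1 + cmod c * cmod (F z))"
      using norm_triangle_ineq[of 1 "cnj c * F z"] \<open>0 \<le> t\<close>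
      by (intro mult_left_mono) (auto simp: d_def norm_mult)
    finally have "R * cmod (F z) \<le> t + t * cmod c * cmod (F z)"
      by (simp add: algebra_simps)
    moreover have "(t * cmod c + q) * cmod (F z) \<le> R * cmod (F z)"
      by (rule mult_right_mono[OF tq]) simp
    ultimately have "q * cmod (F z) \<le> t"
      by (simp add: algebra_simps)
    then have "(q * cmod (F z))\<^sup>2 \<le> t\<^sup>2"
      using q(1) by (intro power_mono) auto
    then show ?thesis
      by (simp add: power_mult_distrib q(2) t_def mult.commute)
  qed
  show "\<exists>\<eta>. cmod \<eta> = 1 \<and> (\<forall>z\<in>ball 0 1. F z = \<eta> * z)" if F1: "cmod (deriv F 0) = 1"
  proof -
    have dF: "(F has_field_derivative deriv F 0) (at 0)"
      by (rule holomorphic_derivI[OF F]) auto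
    have dd: "(d has_field_derivative cnj c * deriv F 0) (at 0)"
      unfolding d_def[abs_def] using DERIV_add[OF DERIV_const[of 1] DERIV_cmult[OF dF, of "cnj c"]] by simp
    have "d 0 = 1"
      by (simp add: d_def F0)
    with DERIV_divide[OF DERIV_cmult[OF dF, of "of_real R"] dd]
    have "(\<omega> has_field_derivative of_real R * deriv F 0) (at 0)"
      by (simp add: \<omega>_def[abs_def] F0)
    then have "deriv \<omega> 0 = of_real R * deriv F 0"
      by (rule DERIV_imp_deriv)
    moreover have "cmod (deriv \<omega> 0) \<le> 1"
      by (rule Schwarz_Lemma(2)[OF \<omega> \<omega>0 \<omega>_less, of 0]) auto
    ultimately have "R = 1"
      using F1 R(1) by (simp add: norm_mult)
    then have "c = 0"
      using R(2) by simp
    then have "F = \<omega>"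
      using \<open>R = 1\<close> by (simp add: \<omega>_def[abs_def] d_def)
    then have "\<exists>\<eta>. (\<forall>z. cmod z < 1 \<longrightarrow> F z = \<eta> * z) \<and> cmod \<eta> = 1"
      using Schwarz_Lemma(3)[OF \<omega> \<omega>0 \<omega>_less, of 0] F1 by simp
    then show ?thesis
      by auto
  qed
qed

section \<open>Normalisation and isometries\<close>

lemma moebius_rotation_injective:
  assumes AB: "A \<noteq> 0 \<or> B \<noteq> 0"
    and p: "moebius A B (- cnj B) (cnj A) p = Some u" and q: "moebius A B (- cnj B) (cnj A) q = Some u"
  shows "p = q"
proof -
  have "0 < (cmod A)\<^sup>2 + (cmod B)\<^sup>2"
    using AB by (auto intro: add_pos_nonneg add_nonneg_pos)
  then have "of_real ((cmod A)\<^sup>2 + (cmod B)\<^sup>2) \<noteq> (0::complex)"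
    by (simp only: of_real_eq_0_iff)
  then have M: "A * cnj A + B * cnj B \<noteq> 0"
    unfolding of_real_add complex_norm_square .
  have None: "u * cnj B = - A" if "moebius A B (- cnj B) (cnj A) None = Some u"
    using that by (auto simp: moebius_def split: if_splits)
  have Some: "u * (cnj A - cnj B * w) = A * w + B"
    if "moebius A B (- cnj B) (cnj A) (Some w) = Some u" for w
    using that by (auto simp: moebius_def split: if_splits)
  have mixed: False if "u * cnj B = - A" "u * (cnj A - cnj B * w) = A * w + B" for w
  proof -
    have "A * cnj A + B * cnj B = cnj B * (A * w + B - u * (cnj A - cnj B * w)) + (cnj A - w * cnj B) * (u * cnj B + A)"
      by (simp add: algebra_simps)
    with that M show False
      by simp
  qed
  show ?thesis
  proof (cases p; cases q)
    fix w w' assume w: "p = Some w" "q = Some w'"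
    have "u * (cnj A - cnj B * w) = A * w + B" "u * (cnj A - cnj B * w') = A * w' + B"
      using Some p q w by auto
    moreover have "(A * cnj A + B * cnj B) * (w - w')
        = (cnj A - cnj B * w') * (A * w + B - u * (cnj A - cnj B * w))
          - (cnj A - cnj B * w) * (A * w' + B - u * (cnj A - cnj B * w'))"
      by (simp add: algebra_simps)
    ultimately show ?thesis
      using M w by simp
  qed (use p q None Some mixed in blast)+
qed

lemma stereo_antipode:
  assumes "1 + cnj a * w = 0"
  shows "stereo (Some w) = - stereo (Some a)"
proof -
  define y where "y = (cmod a)\<^sup>2"
  have a: "a \<noteq> 0"
    using assms by auto
  then have y: "0 < y"
    by (simp add: y_def)
  have "w * of_real y = a * (1 + cnj a * w) - a"
    unfolding y_def complex_norm_square by (simp add: algebra_simps)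
  also have "\<dots> = - a"
    unfolding assms by simp
  finally have w: "w = - a / of_real y"
    using y by (subst eq_divide_eq) simp
  have "(cmod w)\<^sup>2 = (cmod a)\<^sup>2 / y\<^sup>2"
    by (simp add: w norm_divide power_divide)
  also have "\<dots> = 1 / y"
    unfolding y_def[symmetric] using y by (simp add: power2_eq_square)
  finally have "(cmod w)\<^sup>2 = 1 / y" .
  moreover have "2 / (1 + 1 / y) = 2 * y / (1 + y)"
    using y by (simp add: field_simps)
  moreover have "(1 / y - 1) / (1 / y + 1) = - ((y - 1) / (y + 1))"
  proof -
    have "1 / y - 1 = - (y - 1) / y" "1 / y + 1 = (y + 1) / y"
      using y by (simp_all add: field_simps)
    then show ?thesis
      using y by (simp add: minus_divide_left)
  qed
  ultimately show ?thesis
    using y by (simp add: stereo_def y_def[symmetric] w scaleR_conv_of_real)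
qed

text \<open>If \<open>f 0 = a\<close> is finite, rotate by \<open>w \<mapsto> (w - a) / (1 + cnj a w)\<close>; if it is infinite, by \<open>w \<mapsto> - 1 / w\<close>. The
  point sent to infinity is the antipode of \<open>f 0\<close>, which is not a value of \<open>f\<close>. The two shapes of \<open>(A, B)\<close> match
  the two families of isometries.\<close>

lemma normalizing_rotation:
  assumes f: "spherically_convex_map f"
  obtains A B F where "A = 1 \<or> A = 0 \<and> B = 1" "F 0 = 0"
    "\<And>z. z \<in> ball 0 1 \<Longrightarrow> moebius A B (- cnj B) (cnj A) (f z) = Some (F z)"
proof -
  have anti: "stereo (f z) \<noteq> - stereo (f 0)" if "z \<in> ball 0 1" for z
    using spherically_convex_map_no_antipodes[OF f, of 0 z] that by simp
  obtain A B where AB: "A = 1 \<or> A = 0 \<and> B = 1" and zero: "moebius A B (- cnj B) (cnj A) (f 0) = Some 0"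
    and fin: "\<And>z. z \<in> ball 0 1 \<Longrightarrow> moebius A B (- cnj B) (cnj A) (f z) \<noteq> None"
  proof (cases "f 0")
    case None
    show ?thesis
    proof
      show "moebius 0 1 (- cnj 1) (cnj 0) (f z) \<noteq> None" if "z \<in> ball 0 1" for z
        using anti[OF that] None by (cases "f z") (auto simp: moebius_def stereo_def)
    qed (auto simp: None moebius_def)
  next
    case (Some a)
    have "0 < 1 + (cmod a)\<^sup>2"
      by (simp add: add_pos_nonneg)
    then have "1 + a * cnj a \<noteq> 0"
      by (metis complex_norm_square of_real_1 of_real_add of_real_eq_0_iff less_irrefl)
    show ?thesis
    proof
      show "moebius 1 (- a) (- cnj (- a)) (cnj 1) (f z) \<noteq> None" if "z \<in> ball 0 1" for z
      proof (cases "f z")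
        case None
        with anti[OF that] Some show ?thesis
          by (auto simp: moebius_def stereo_def)
      next
        case (Some w)
        with anti[OF that] \<open>f 0 = Some a\<close> stereo_antipode[of a w] show ?thesis
          by (auto simp: moebius_def add.commute)
      qed
      show "moebius 1 (- a) (- cnj (- a)) (cnj 1) (f 0) = Some 0"
        using \<open>1 + a * cnj a \<noteq> 0\<close> by (simp add: Some moebius_def algebra_simps)
    qed simp
  qed
  show ?thesis
  proof
    show "A = 1 \<or> A = 0 \<and> B = 1"
      by fact
    show "the (moebius A B (- cnj B) (cnj A) (f 0)) = 0"
      by (simp add: zero)
    show "moebius A B (- cnj B) (cnj A) (f z) = Some (the (moebius A B (- cnj B) (cnj A) (f z)))"
      if "z \<in> ball 0 1" for z
      using fin[OF that] by simp
  qed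
qed

lemma cis_of_unit:
  assumes "cmod \<eta> = 1"
  obtains \<theta> where "\<eta> = cis \<theta>"
  using assms cis_Arg by (metis norm_zero sgn_eq zero_neq_one div_by_1 of_real_1)

text \<open>Solve the equation for \<open>f z\<close>. For \<open>A = 1\<close> the inverse rotation of \<open>\<eta> z\<close> is
  \<open>(\<eta> z - B) / (1 + cnj B \<eta> z)\<close>, for \<open>A = 0\<close> it is \<open>- 1 / (\<eta> z)\<close>.\<close>

lemma isometry_if_rotated_linear:
  assumes AB: "A = 1 \<or> A = 0 \<and> B = 1" and \<eta>: "cmod \<eta> = 1"
    and F: "\<And>z. z \<in> ball 0 1 \<Longrightarrow> moebius A B (- cnj B) (cnj A) (f z) = Some (\<eta> * z)"
  shows "spherical_isometry_on_disc f"
proof -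
  have \<eta>\<eta>: "\<eta> * cnj \<eta> = 1"
    using \<eta> complex_norm_square[of \<eta>] by simp
  from AB show ?thesis
  proof
    assume A: "A = 1"
    obtain \<theta> where \<theta>: "\<eta> = cis \<theta>"
      using cis_of_unit[OF \<eta>] .
    define T where "T = moebius (cis \<theta>) (- cis \<theta> * (B * cnj \<eta>)) (cnj (B * cnj \<eta>)) 1"
    have T_eq: "T = moebius \<eta> (- B) (cnj B * \<eta>) 1"
      using \<eta>\<eta> by (simp add: T_def \<theta>[symmetric] algebra_simps)
    have "f z = T (Some z)" if z: "z \<in> ball 0 1" for z
    proof (cases "f z")
      case None
      then have "B \<noteq> 0" "\<eta> * z * cnj B = - 1"
        using F[OF z] by (auto simp: A moebius_def field_simps split: if_splits)
      then show ?thesis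
        by (simp add: None T_eq moebius_def algebra_simps)
    next
      case (Some w)
      then have e: "1 - cnj B * w \<noteq> 0" and "(w + B) / (1 - cnj B * w) = \<eta> * z"
        using F[OF z] by (auto simp: A moebius_def split: if_splits)
      then have w: "w + B = \<eta> * z * (1 - cnj B * w)"
        by (simp add: field_simps)
      have "cnj B * \<eta> * z + 1 \<noteq> 0"
      proof
        assume *: "cnj B * \<eta> * z + 1 = 0"
        have "\<eta> * z - B = w * (cnj B * \<eta> * z + 1)"
          using w by (simp add: algebra_simps)
        then have "\<eta> * z = B"
          unfolding * by simp
        with * have "B * cnj B + 1 = 0"
          by (simp add: mult.assoc mult.commute[of B])
        then have "complex_of_real ((cmod B)\<^sup>2 + 1) = of_real 0"
          by (simp only: of_real_add complex_norm_square of_real_1 of_real_0)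
        then have "(cmod B)\<^sup>2 + 1 = 0"
          by (simp only: of_real_eq_iff)
        then show False
          using zero_le_power2[of "cmod B"] by linarith
      qed
      moreover have "w * (cnj B * \<eta> * z + 1) = \<eta> * z - B"
        using w by (simp add: algebra_simps)
      ultimately show ?thesis
        by (simp add: Some T_eq moebius_def field_simps)
    qed
    moreover have "T \<in> Rot"
      unfolding Rot_def T_def by blast
    ultimately show ?thesis
      unfolding spherical_isometry_on_disc_def by blast
  next
    assume A: "A = 0 \<and> B = 1"
    obtain \<theta> where \<theta>: "- cnj \<eta> = cis \<theta>"
      using cis_of_unit[of "- cnj \<eta>"] \<eta> by auto
    have "f z = moebius 0 (cis \<theta>) 1 0 (Some z)" if z: "z \<in> ball 0 1" for z
    proof (cases "f z")
      case None
      then have "z = 0"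
        using F[OF z] \<eta> by (auto simp: A moebius_def)
      then show ?thesis
        using None by (simp add: moebius_def)
    next
      case (Some w)
      then have w: "w \<noteq> 0" "\<eta> * z * w = - 1"
        using F[OF z] by (auto simp: A moebius_def field_simps split: if_splits)
      then have "z \<noteq> 0"
        by auto
      have "z * w = (cnj \<eta> * \<eta>) * (z * w)"
        using \<eta>\<eta> by (simp add: mult.commute)
      also have "\<dots> = - cnj \<eta>"
        using w(2) by (simp add: mult.assoc)
      finally show ?thesis
        using \<open>z \<noteq> 0\<close> by (simp add: Some moebius_def \<theta>[symmetric] field_simps)
    qed
    moreover have "moebius 0 (cis \<theta>) 1 0 \<in> Rot"
      unfolding Rot_def by blast
    ultimately show ?thesis
      unfolding spherical_isometry_on_disc_def by blast
  qed
qed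

text \<open>Compose with the inverse isometry, up to a rotation about the origin; in this way the spherical derivative
  of an isometry, also at its pole, follows from \<open>rotated_meromorphic_map\<close>.\<close>

lemma isometry_rotated_linear:
  assumes "spherical_isometry_on_disc f"
  obtains A B \<eta> where "A \<noteq> 0 \<or> B \<noteq> 0" "cmod \<eta> = 1"
    "\<And>z. z \<in> ball 0 1 \<Longrightarrow> moebius A B (- cnj B) (cnj A) (f z) = Some (\<eta> * z)"
proof -
  from assms obtain T where T: "T \<in> Rot" "\<And>z. z \<in> ball 0 1 \<Longrightarrow> f z = T (Some z)"
    unfolding spherical_isometry_on_disc_def by blast
  have pp: "cis \<theta> * cis (- \<theta>) = 1" for \<theta>
    by (simp add: cis_mult)
  from T(1) consider a \<theta> where "T = moebius (cis \<theta>) (- cis \<theta> * a) (cnj a) 1"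
    | \<theta> where "T = moebius 0 (cis \<theta>) 1 0"
    unfolding Rot_def by blast
  then show ?thesis
  proof cases
    case 1
    define B where "B = cis \<theta> * a"
    have B_cnj: "cnj B * cis \<theta> = cnj a"
      using pp[of \<theta>] by (simp add: B_def cis_cnj mult_ac)
    have "0 < 1 + (cmod a)\<^sup>2"
      by (simp add: add_pos_nonneg)
    then have m: "1 + a * cnj a \<noteq> 0"
      by (metis complex_norm_square of_real_1 of_real_add of_real_eq_0_iff less_irrefl)
    have "moebius 1 B (- cnj B) (cnj 1) (T (Some z)) = Some (cis \<theta> * z)" for z
    proof (cases "cnj a * z + 1 = 0")
      case True
      then have "a \<noteq> 0"
        by auto
      then have "B \<noteq> 0"
        by (simp add: B_def)
      have "cnj B * (cis \<theta> * z) = - 1"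
        using True B_cnj by (simp add: mult.assoc[symmetric] eq_neg_iff_add_eq_0)
      then have "cis \<theta> * z = 1 / (- cnj B)"
        using \<open>B \<noteq> 0\<close> by (simp add: field_simps)
      then show ?thesis
        using True \<open>B \<noteq> 0\<close> by (simp add: 1 moebius_def)
    next
      case False
      define w where "w = (cis \<theta> * z - cis \<theta> * a) / (cnj a * z + 1)"
      have w: "w * (cnj a * z + 1) = cis \<theta> * z - cis \<theta> * a"
        using False by (simp add: w_def)
      have Tz: "T (Some z) = Some w"
        using False by (simp add: 1 moebius_def w_def)
      have "(1 - cnj B * w) * (cnj a * z + 1) = cnj a * z + 1 - cnj B * (w * (cnj a * z + 1))"
        by (simp add: algebra_simps)
      also have "\<dots> = cnj a * z + 1 - cnj B * (cis \<theta> * z - cis \<theta> * a)"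
        unfolding w ..
      also have "\<dots> = 1 + a * cnj a"
      proof -
        have "cnj B * (cis \<theta> * z - cis \<theta> * a) = (cnj B * cis \<theta>) * (z - a)"
          by (simp add: algebra_simps)
        then show ?thesis
          unfolding B_cnj by (simp add: algebra_simps)
      qed
      finally have e: "(1 - cnj B * w) * (cnj a * z + 1) = 1 + a * cnj a" .
      then have e_nz: "1 - cnj B * w \<noteq> 0"
        using m by auto
      have "(w + B) * (cnj a * z + 1) = cis \<theta> * z * (1 + a * cnj a)"
        using w by (simp add: algebra_simps B_def)
      also have "\<dots> = cis \<theta> * z * (1 - cnj B * w) * (cnj a * z + 1)"
        using e by (simp add: mult.assoc)
      finally have "w + B = cis \<theta> * z * (1 - cnj B * w)"
        using False by simp
      then show ?thesis
        using e_nz by (simp add: Tz moebius_def)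
    qed
    then show ?thesis
      using that[of 1 B "cis \<theta>"] T(2) by simp
  next
    case 2
    have "moebius 0 1 (- cnj 1) (cnj 0) (T (Some z)) = Some (- cis (- \<theta>) * z)" for z
    proof (cases "z = 0")
      case False
      have "1 / (- (cis \<theta> / z)) = - cis (- \<theta>) * z"
        using pp[of \<theta>] False by (simp add: field_simps)
      then show ?thesis
        using False by (simp add: 2 moebius_def)
    qed (simp add: 2 moebius_def)
    then show ?thesis
      using that[of 0 1 "- cis (- \<theta>)"] T(2) by simp
  qed
qed

section \<open>The area theorem\<close>

lemma finite_sph_deriv_linear:
  assumes "cmod \<eta> = 1"
  shows "finite_sph_deriv (\<lambda>z. \<eta> * z) z = 1 / (1 + (cmod z)\<^sup>2)"
proof -
  have "deriv (\<lambda>z. \<eta> * z) z = \<eta>"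
    by (rule DERIV_imp_deriv) (auto intro!: derivative_eq_intros)
  then show ?thesis
    using assms by (simp add: finite_sph_deriv_def norm_mult)
qed

text \<open>The circle formula for the identity map.\<close>

lemma sph_area_disc_eq:
  assumes "0 < r" "r < 1"
  shows "sph_area_disc r = pi * (r\<^sup>2 / (1 + r\<^sup>2))"
proof -
  have "sph_area_disc r = (LINT z:ball 0 r|lborel. (finite_sph_deriv (\<lambda>z. z * 1) z)\<^sup>2)"
    using finite_sph_deriv_linear[of 1] by (simp add: sph_area_disc_def power_divide)
  also have "\<dots> = pi * (r\<^sup>2 / (1 + r\<^sup>2))"
  proof (subst spherical_area_eq_circle_integral)
    have "1 + r\<^sup>2 \<noteq> 0" "2 + r\<^sup>2 * 2 \<noteq> 0"
      using zero_le_power2[of r] by linarith+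
    then show "integral {0..2*pi} (\<lambda>\<theta>. (cmod (of_real r * cis \<theta> * 1))\<^sup>2 / (1 + (cmod (of_real r * cis \<theta> * 1))\<^sup>2)
        * (1 + Re (of_real r * cis \<theta> * deriv (\<lambda>z. 1) (of_real r * cis \<theta>) / 1))) / 2 = pi * (r\<^sup>2 / (1 + r\<^sup>2))"
      using assms by (simp add: norm_mult) (simp add: frac_eq_eq algebra_simps)
  qed (use assms in auto)
  finally show ?thesis .
qed

theorem corollary1p1:
  fixes f :: "complex \<Rightarrow> rsphere"
  assumes "spherically_convex_map f"
  shows "(\<forall>r. 0 < r \<and> r < 1 \<longrightarrow> sph_area_image f r \<ge> sph_area_disc r * (sph_deriv f 0)\<^sup>2) \<and>
         ((\<exists>r. 0 < r \<and> r < 1 \<and> sph_area_image f r = sph_area_disc r * (sph_deriv f 0)\<^sup>2)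
            \<longleftrightarrow> spherical_isometry_on_disc f)"
proof -
  have mero: "meromorphic_map_on f (ball 0 1)" and inj: "inj_on f (ball 0 1)"
    using assms by (auto simp: spherically_convex_map_def)
  obtain A B F where AB: "A = 1 \<or> A = 0 \<and> B = 1" and F0: "F 0 = 0"
    and F: "\<And>z. z \<in> ball 0 1 \<Longrightarrow> moebius A B (- cnj B) (cnj A) (f z) = Some (F z)"
    using normalizing_rotation[OF assms] by blast
  have AB': "A \<noteq> 0 \<or> B \<noteq> 0"
    using AB by auto
  from F have "\<forall>z\<in>ball 0 1. moebius A B (- cnj B) (cnj A) (f z) = Some (F z)"
    by blast
  note F_hol = rotated_meromorphic_map(1)[OF mero inj AB' this]
    and sph = rotated_meromorphic_map(2)[OF mero inj AB' this]
  have F_inj: "inj_on F (ball 0 1)"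
  proof (rule inj_onI)
    fix z w :: complex assume zw: "z \<in> ball 0 1" "w \<in> ball 0 1" "F z = F w"
    have "f z = f w"
      by (rule moebius_rotation_injective[OF AB' F[OF zw(1)]]) (simp add: F[OF zw(2)] zw(3))
    then show "z = w"
      using inj zw(1,2) by (auto dest: inj_onD)
  qed
  obtain n where n: "n \<noteq> 0" "\<And>z. z \<in> ball 0 1 \<Longrightarrow> 0 \<le> n \<bullet> stereo (f z)"
    using spherically_convex_map_in_hemisphere[OF assms] by blast
  obtain \<alpha> \<beta> where \<alpha>\<beta>: "\<alpha> \<noteq> 0 \<or> \<beta> \<noteq> 0"
    "\<And>p u. moebius A B (- cnj B) (cnj A) p = Some u \<Longrightarrow> 0 \<le> n \<bullet> stereo p
       \<Longrightarrow> 0 \<le> \<alpha> * (1 - (cmod u)\<^sup>2) + 2 * Re (\<beta> * u)"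
    using hemisphere_rotation[OF AB' n(1)] by blast
  have half: "\<forall>z\<in>ball 0 1. 0 \<le> \<alpha> * (1 - (cmod (F z))\<^sup>2) + 2 * Re (\<beta> * F z)"
    using \<alpha>\<beta>(2)[OF F n(2)] by blast
  note growth = growth_in_hemisphere[OF F_hol F_inj F0 \<alpha>\<beta>(1) half]

  obtain G where G: "G holomorphic_on ball 0 1" and FG: "\<And>z. cmod z < 1 \<Longrightarrow> F z = z * G z"
    and G0: "deriv F 0 = G 0"
    using Schwarz3[OF F_hol F0] by blast
  have F'0: "deriv F 0 \<noteq> 0"
    using holomorphic_injective_imp_regular[OF F_hol open_ball F_inj] by simp
  \<comment> \<open>By injectivity, \<open>F\<close> vanishes only at \<open>0\<close>, and there to first order.\<close>
  have G_nz: "\<forall>z\<in>ball 0 1. G z \<noteq> 0"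
  proof
    fix z :: complex assume z: "z \<in> ball 0 1"
    show "G z \<noteq> 0"
    proof (cases "z = 0")
      case False
      then have "F z \<noteq> F 0"
        using F_inj z by (metis centre_in_ball inj_onD zero_less_one)
      then show ?thesis
        using FG[of z] z F0 by auto
    qed (use F'0 G0 in simp)
  qed
  have G_growth_nz: "(cmod (G z))\<^sup>2 * (1 - (cmod z)\<^sup>2) \<le> 1" if z: "z \<in> ball 0 1" "z \<noteq> 0" for z
  proof -
    have "(cmod z)\<^sup>2 * ((cmod (G z))\<^sup>2 * (1 - (cmod z)\<^sup>2)) \<le> (cmod z)\<^sup>2 * 1"
      using growth(1)[OF z(1)] FG[of z] z by (simp add: norm_mult power_mult_distrib mult.assoc)
    then show ?thesis
      by (rule mult_left_le_imp_le) (use z(2) in simp)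
  qed
  \<comment> \<open>At the origin the growth bound for \<open>F\<close> is void; for \<open>G\<close> it survives in the limit.\<close>
  have G0_le: "(cmod (G 0))\<^sup>2 \<le> 1"
  proof (rule tendsto_upperbound)
    have "isCont G 0"
      using G by (metis centre_in_ball continuous_on_eq_continuous_at holomorphic_on_imp_continuous_on
          open_ball zero_less_one)
    then have "isCont (\<lambda>z. (cmod (G z))\<^sup>2 * (1 - (cmod z)\<^sup>2)) 0"
      by (intro continuous_intros)
    then show "((\<lambda>z. (cmod (G z))\<^sup>2 * (1 - (cmod z)\<^sup>2)) \<longlongrightarrow> (cmod (G 0))\<^sup>2) (at 0)"
      by (simp add: isCont_def)
    have "\<forall>\<^sub>F z in at 0. z \<in> ball (0::complex) 1 \<and> z \<noteq> 0"
      by (intro eventually_conj eventually_at_in_open') (auto simp: eventually_at_filter)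
    then show "\<forall>\<^sub>F z in at 0. (cmod (G z))\<^sup>2 * (1 - (cmod z)\<^sup>2) \<le> 1"
      by eventually_elim (use G_growth_nz in blast)
  qed simp
  have G_growth: "\<forall>z\<in>ball 0 1. (cmod (G z))\<^sup>2 * (1 - (cmod z)\<^sup>2) \<le> 1"
  proof
    fix z :: complex assume "z \<in> ball 0 1"
    then show "(cmod (G z))\<^sup>2 * (1 - (cmod z)\<^sup>2) \<le> 1"
      using G_growth_nz[of z] G0_le by (cases "z = 0") simp_all
  qed

  define a where "a = (cmod (G 0))\<^sup>2"
  have a: "0 < a" "a \<le> 1"
    using G_nz G0_le by (auto simp: a_def)
  have sph0: "(sph_deriv f 0)\<^sup>2 = a"
    using sph[of 0] by (simp add: finite_sph_deriv_def F0 G0 a_def)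
  have area: "sph_area_image f r \<ge> pi * (r\<^sup>2 * a / (1 + r\<^sup>2 * a))" if r: "0 < r" "r < 1" for r
  proof -
    have "sph_deriv f z = finite_sph_deriv (\<lambda>z. z * G z) z" if z: "z \<in> ball 0 r" for z
    proof -
      have z1: "z \<in> ball 0 1"
        using z r by simp
      have "deriv F z = deriv (\<lambda>z. z * G z) z"
        by (rule deriv_cong_ev, rule eventually_mono[OF eventually_nhds_in_open[of "ball 0 1" z]])
           (use z1 FG in auto)
      then show ?thesis
        using sph[OF z1] FG[of z] z1 by (simp add: finite_sph_deriv_def)
    qed
    then have "sph_area_image f r = (LINT z:ball 0 r|lborel. (finite_sph_deriv (\<lambda>z. z * G z) z)\<^sup>2)"
      unfolding sph_area_image_def by (intro set_lebesgue_integral_cong) auto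
    then show ?thesis
      using spherical_area_lower_bound[OF G G_nz G_growth r] by (simp add: a_def)
  qed
  \<comment> \<open>The area bound exceeds the claimed one because \<open>a \<le> 1\<close>, strictly unless \<open>a = 1\<close>.\<close>
  have gap: "sph_area_disc r * (sph_deriv f 0)\<^sup>2 \<le> pi * (r\<^sup>2 * a / (1 + r\<^sup>2 * a))"
    "sph_area_disc r * (sph_deriv f 0)\<^sup>2 = pi * (r\<^sup>2 * a / (1 + r\<^sup>2 * a)) \<Longrightarrow> a = 1"
    if r: "0 < r" "r < 1" for r
  proof -
    have lhs: "sph_area_disc r * (sph_deriv f 0)\<^sup>2 = pi * (r\<^sup>2 * a / (1 + r\<^sup>2))"
      by (simp add: sph_area_disc_eq[OF r] sph0)
    have pos: "0 < 1 + r\<^sup>2 * a"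
      using a by (intro add_pos_nonneg) auto
    show "sph_area_disc r * (sph_deriv f 0)\<^sup>2 \<le> pi * (r\<^sup>2 * a / (1 + r\<^sup>2 * a))"
      unfolding lhs using a r pos 
      by (intro mult_left_mono divide_left_mono mult_pos_pos add_pos_nonneg) (auto simp: mult_left_le)
    assume "sph_area_disc r * (sph_deriv f 0)\<^sup>2 = pi * (r\<^sup>2 * a / (1 + r\<^sup>2 * a))"
    then have "r\<^sup>2 * a / (1 + r\<^sup>2) = r\<^sup>2 * a / (1 + r\<^sup>2 * a)"
      unfolding lhs by simp
    moreover have "r\<^sup>2 * a \<noteq> 0" "1 + r\<^sup>2 \<noteq> 0"
      using a r by (auto simp: add_pos_nonneg less_imp_neq[symmetric])
    ultimately have "1 + r\<^sup>2 = 1 + r\<^sup>2 * a"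
      using pos by (simp add: frac_eq_eq)
    then show "a = 1"
      using r by simp
  qed
  show ?thesis
  proof (intro conjI allI impI iffI)
    fix r :: real assume "0 < r \<and> r < 1"
    then show "sph_area_image f r \<ge> sph_area_disc r * (sph_deriv f 0)\<^sup>2"
      using area gap(1) by (meson order.trans)
  next
    assume "\<exists>r. 0 < r \<and> r < 1 \<and> sph_area_image f r = sph_area_disc r * (sph_deriv f 0)\<^sup>2"
    then obtain r where r: "0 < r" "r < 1" "sph_area_image f r = sph_area_disc r * (sph_deriv f 0)\<^sup>2"
      by blast
    then have "a = 1"
      using area[OF r(1,2)] gap[OF r(1,2)] by linarith
    then have "cmod (deriv F 0) = 1"
      by (simp add: a_def G0 power2_eq_1_iff) (smt (verit) norm_ge_zero)
    then obtain \<eta> where "cmod \<eta> = 1" "\<forall>z\<in>ball 0 1. F z = \<eta> * z"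
      using growth(2) by blast
    then show "spherical_isometry_on_disc f"
      using isometry_if_rotated_linear[OF AB] F by simp
  next
    assume "spherical_isometry_on_disc f"
    then obtain A' B' \<eta> where iso: "A' \<noteq> 0 \<or> B' \<noteq> 0" "cmod \<eta> = 1"
      "\<forall>z\<in>ball 0 1. moebius A' B' (- cnj B') (cnj A') (f z) = Some (\<eta> * z)"
      using isometry_rotated_linear by metis
    have eq: "sph_deriv f z = 1 / (1 + (cmod z)\<^sup>2)" if "z \<in> ball 0 1" for z
      using rotated_meromorphic_map(2)[OF mero inj iso(1) iso(3) that] finite_sph_deriv_linear[OF iso(2)]
      by simp
    have "sph_area_image f (1/2) = sph_area_disc (1/2)"
      unfolding sph_area_image_def sph_area_disc_def
      by (intro set_lebesgue_integral_cong) (auto simp: eq power_divide)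
    then show "\<exists>r. 0 < r \<and> r < 1 \<and> sph_area_image f r = sph_area_disc r * (sph_deriv f 0)\<^sup>2"
      using eq[of 0] by (intro exI[of _ "1/2"]) simp
  qed
qed

end
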